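(* Let $n\ge1$, $v\in\mathbb{C}^*$ not a root of unity, $\mathtt m,k\in\mathbb{Z}$. The sequences of operators $\Phi_k:\Lambda^N\to\Lambda^{N+1}$ and $\tilde\Phi_k^*=[N]_v^+\Phi_k^*:\Lambda^N\to\Lambda^{N-1}$ ($N=1,2,\dots$) stabilize.
   Context: $V=\mathbb{C}^n[Y^{\pm1}]$, $\mathbb{C}^n$ with basis $e_0,\dots,e_{n-1}$; $e_{nj+a}=Y^je_a$ ($j\in\mathbb{Z}$, $0\le a<n$). Identify $V^{\otimes N}=(\mathbb{C}^n)^{\otimes N}[Y_1^{\pm1},\dots,Y_N^{\pm1}]$. Hecke generators act by $T_i=s_i^YR_{i,i+1}+(v-v^{-1})\frac{s_i^Y-1}{Y_i/Y_{i+1}-1}$, where $s^Y_i$ swaps only the variables $Y_i,Y_{i+1}$ and $R=v\sum_aE_{aa}\otimes E_{aa}+\sum_{a<b}(E_{ab}\otimes E_{ba}+E_{ba}\otimes E_{ab}+(v-v^{-1})E_{aa}\otimes E_{bb})$ acts on tensor factors $i,i+1$. $[i]^{\pm}_v=\frac{v^{\pm2i}-1}{v^{\pm2}-1}$, $[N]!^-_v=\prod_{i=1}^N[i]_v^-$, $\mathbf{S}_-=\frac1{[N]!^-_v}\sum_{w\in S_N}(-v)^{-\ell(w)}T_w$, $\Lambda^N=\mathbf{S}_-V^{\otimes N}$, $e_{i_1}\wedge\dots\wedge e_{i_N}=\mathbf{S}_-(e_{i_1}\otimes\dots\otimes e_{i_N})$; those with $i_1<\dots<i_N$ form a basis of $\Lambda^N$.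 $\varphi^{(\mathtt m)}_{N+1,N}:\Lambda^N\to\Lambda^{N+1}$, $w\mapsto w\wedge e_{N-\mathtt m}$ (i.e. the linear map $e_{i_1}\wedge\dots\wedge e_{i_N}\mapsto e_{i_1}\wedge\dots\wedge e_{i_N}\wedge e_{N-\mathtt m}$), and $\varphi^{(\mathtt m)}_{R,N}$ ($R>N$) are the composites. $\Phi_k(w)=e_k\wedge w$. For $w=\sum y_{t_1,\dots,t_N}e_{t_1}\otimes\dots\otimes e_{t_N}\in\Lambda^N\subset V^{\otimes N}$, $\Phi^*_k(w)=\sum_{t_2,\dots,t_N}y_{-k,t_2,\dots,t_N}e_{t_2}\otimes\dots\otimes e_{t_N}$, which lies in $\Lambda^{N-1}$. A sequence $A^{(N)}:\Lambda^N\to\Lambda^{N+\delta}$ *stabilizes* if for any $l$ and $w\in\Lambda^l$ there is $M$ such that for all $N>M$: $\varphi^{(\mathtt m+\delta)}_{N+n+\delta,N+\delta}\circ A^{(N)}\circ\varphi^{(\mathtt m)}_{N,l}(w)=A^{(N+n)}\circ\varphi^{(\mathtt m)}_{N+n,l}(w)$. *)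

theory Defs
  imports Complex_Main "HOL-Library.Poly_Mapping" "HOL-Combinatorics.Permutations"
begin

text \<open>
  The index list \<open>[t\<^sub>1, \<dots>, t\<^sub>N]\<close> stands for the basis vector \<open>e\<^bsub>t\<^sub>1\<^esub> \<otimes> \<dots> \<otimes> e\<^bsub>t\<^sub>N\<^esub>\<close> of
  \<open>V\<^sup>\<otimes>\<^sup>N\<close>, where an integer \<open>t = n j + a\<close> with \<open>0 \<le> a < n\<close> stands for \<open>e\<^sub>t = Y\<^sup>j e\<^sub>a\<close>; thus
  \<open>j = t div n\<close> and \<open>a = t mod n\<close>. Tensor factors are numbered from 0, so the factors
  \<open>i, i + 1\<close> of the usual numbering from 1 are the positions \<open>i - 1, i\<close> of the list.
\<close>

type_synonym tensor = "int list \<Rightarrow>\<^sub>0 complex"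

definition scl :: "complex \<Rightarrow> tensor \<Rightarrow> tensor" where
  "scl c x = Poly_Mapping.map ((*) c) x"

definition basis :: "int list \<Rightarrow> tensor" where
  "basis t = Poly_Mapping.single t 1"

definition lin_ext :: "(int list \<Rightarrow> tensor) \<Rightarrow> tensor \<Rightarrow> tensor" where
  "lin_ext f x = (\<Sum>t\<in>Poly_Mapping.keys x. scl (Poly_Mapping.lookup x t) (f t))"

definition tens :: "nat \<Rightarrow> tensor set" where
  "tens N = {x. Poly_Mapping.keys x \<subseteq> {t. length t = N}}"

definition linear_between :: "tensor set \<Rightarrow> tensor set \<Rightarrow> (tensor \<Rightarrow> tensor) \<Rightarrow> bool" where
  "linear_between X Y A \<longleftrightarrow>
     (\<forall>x\<in>X. A x \<in> Y) \<and>
     (\<forall>x\<in>X. \<forall>y\<in>X. A (x + y) = A x + A y) \<and>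
     (\<forall>c. \<forall>x\<in>X. A (scl c x) = scl c (A x))"

subsection \<open>The action of the affine Hecke algebra\<close>

text \<open>The matrix unit \<open>E\<^sub>a\<^sub>b\<close>, with \<open>E\<^sub>a\<^sub>b e\<^sub>b = e\<^sub>a\<close>, acting on the tensor factor at position \<open>i\<close>.\<close>

definition matunit :: "nat \<Rightarrow> nat \<Rightarrow> int \<Rightarrow> int \<Rightarrow> tensor \<Rightarrow> tensor" where
  "matunit n i a b = lin_ext (\<lambda>t.
     if t ! i mod int n = b then basis (t[i := int n * (t ! i div int n) + a]) else 0)"

definition Rmat :: "nat \<Rightarrow> complex \<Rightarrow> nat \<Rightarrow> tensor \<Rightarrow> tensor" where
  "Rmat n v i x =
     scl v (\<Sum>a\<in>{0..<int n}. matunit n i a a (matunit n (Suc i) a a x)) +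
     (\<Sum>b\<in>{0..<int n}. \<Sum>a\<in>{0..<b}.
        matunit n i a b (matunit n (Suc i) b a x) +
        matunit n i b a (matunit n (Suc i) a b x) +
        scl (v - inverse v) (matunit n i a a (matunit n (Suc i) b b x)))"

definition swapY :: "nat \<Rightarrow> nat \<Rightarrow> tensor \<Rightarrow> tensor" where
  "swapY n i = lin_ext (\<lambda>t. basis
     (t[i := int n * (t ! Suc i div int n) + t ! i mod int n,
        Suc i := int n * (t ! i div int n) + t ! Suc i mod int n]))"

text \<open>Multiplication by \<open>Y\<^sub>i\<^sup>d\<close>.\<close>

definition multY :: "nat \<Rightarrow> nat \<Rightarrow> int \<Rightarrow> tensor \<Rightarrow> tensor" where
  "multY n i d = lin_ext (\<lambda>t. basis (t[i := t ! i + int n * d]))"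

text \<open>The quotient \<open>(s\<^sub>i\<^sup>Y x - x) / (Y\<^sub>i / Y\<^sub>i\<^sub>+\<^sub>1 - 1)\<close> in \<open>V\<^sup>\<otimes>\<^sup>N\<close>.\<close>

definition divdiff :: "nat \<Rightarrow> nat \<Rightarrow> nat \<Rightarrow> tensor \<Rightarrow> tensor" where
  "divdiff n N i x =
     (THE g. g \<in> tens N \<and> multY n i 1 (multY n (Suc i) (-1) g) - g = swapY n i x - x)"

definition hecke :: "nat \<Rightarrow> complex \<Rightarrow> nat \<Rightarrow> nat \<Rightarrow> tensor \<Rightarrow> tensor" where
  "hecke n v N i x = swapY n i (Rmat n v i x) + scl (v - inverse v) (divdiff n N i x)"

subsection \<open>The antisymmetrizer and the wedge space\<close>

text \<open>A word in the indices \<open>i < N - 1\<close> represents the product, in the order of the word, of the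
  adjacent transpositions \<open>(i i+1)\<close> of \<open>{..<N}\<close>.\<close>

definition words :: "nat \<Rightarrow> nat list set" where
  "words N = {is. \<forall>i\<in>set is. Suc i < N}"

definition word_perm :: "nat list \<Rightarrow> nat \<Rightarrow> nat" where
  "word_perm is = foldr (\<lambda>i p. transpose i (Suc i) \<circ> p) is id"

definition perm_length :: "nat \<Rightarrow> (nat \<Rightarrow> nat) \<Rightarrow> nat" where
  "perm_length N w = (LEAST l. \<exists>is\<in>words N. length is = l \<and> word_perm is = w)"

definition reduced_word :: "nat \<Rightarrow> (nat \<Rightarrow> nat) \<Rightarrow> nat list \<Rightarrow> bool" where
  "reduced_word N w is \<longleftrightarrow> is \<in> words N \<and> word_perm is = w \<and> length is = perm_length N w"

text \<open>By the braid relations \<open>T\<^sub>w\<close> is independent of the reduced word chosen.\<close>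

definition hecke_perm :: "nat \<Rightarrow> complex \<Rightarrow> nat \<Rightarrow> (nat \<Rightarrow> nat) \<Rightarrow> tensor \<Rightarrow> tensor" where
  "hecke_perm n v N w = foldr (hecke n v N) (SOME is. reduced_word N w is)"

definition qnum_plus :: "complex \<Rightarrow> nat \<Rightarrow> complex" where
  "qnum_plus v i = (v powi (2 * int i) - 1) / (v powi 2 - 1)"

definition qnum_minus :: "complex \<Rightarrow> nat \<Rightarrow> complex" where
  "qnum_minus v i = (v powi (- 2 * int i) - 1) / (v powi (- 2) - 1)"

definition qfact_minus :: "complex \<Rightarrow> nat \<Rightarrow> complex" where
  "qfact_minus v N = (\<Prod>i=1..N. qnum_minus v i)"

definition antisym :: "nat \<Rightarrow> complex \<Rightarrow> nat \<Rightarrow> tensor \<Rightarrow> tensor" where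
  "antisym n v N x = scl (1 / qfact_minus v N)
     (\<Sum>w\<in>{w. w permutes {..<N}}. scl ((- v) powi (- int (perm_length N w))) (hecke_perm n v N w x))"

definition Wedge :: "nat \<Rightarrow> complex \<Rightarrow> nat \<Rightarrow> tensor set" where
  "Wedge n v N = antisym n v N ` tens N"

subsection \<open>Wedging with a basis vector\<close>

text \<open>
  The linear maps \<open>e\<^bsub>i\<^sub>1\<^esub> \<and> \<dots> \<and> e\<^bsub>i\<^sub>N\<^esub> \<mapsto> e\<^bsub>i\<^sub>1\<^esub> \<and> \<dots> \<and> e\<^bsub>i\<^sub>N\<^esub> \<and> e\<^sub>j\<close> and
  \<open>e\<^bsub>i\<^sub>1\<^esub> \<and> \<dots> \<and> e\<^bsub>i\<^sub>N\<^esub> \<mapsto> e\<^sub>k \<and> e\<^bsub>i\<^sub>1\<^esub> \<and> \<dots> \<and> e\<^bsub>i\<^sub>N\<^esub>\<close> on the wedge space: an element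
  \<open>w\<close> is a linear combination of wedge monomials in the form \<open>w = antisym n v N x\<close>, and the value
  does not depend on the choice of \<open>x\<close>.
\<close>

definition wedge_right :: "nat \<Rightarrow> complex \<Rightarrow> nat \<Rightarrow> int \<Rightarrow> tensor \<Rightarrow> tensor" where
  "wedge_right n v N j w =
     (THE y. \<exists>x\<in>tens N. w = antisym n v N x \<and>
        y = antisym n v (Suc N) (lin_ext (\<lambda>t. basis (t @ [j])) x))"

definition wedge_left :: "nat \<Rightarrow> complex \<Rightarrow> nat \<Rightarrow> int \<Rightarrow> tensor \<Rightarrow> tensor" where
  "wedge_left n v N k w =
     (THE y. \<exists>x\<in>tens N. w = antisym n v N x \<and>
        y = antisym n v (Suc N) (lin_ext (\<lambda>t. basis (k # t)) x))"

text \<open>The transition map from the \<open>N\<close>-th to the \<open>R\<close>-th wedge space for \<open>R \<ge> N\<close>; it is the identity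
  for \<open>R = N\<close>.\<close>

definition phi :: "nat \<Rightarrow> complex \<Rightarrow> int \<Rightarrow> nat \<Rightarrow> nat \<Rightarrow> tensor \<Rightarrow> tensor" where
  "phi n v m R N = fold (\<lambda>K. wedge_right n v K (int K - m)) [N..<R]"

subsection \<open>The operators and stabilization\<close>

definition Phi :: "nat \<Rightarrow> complex \<Rightarrow> int \<Rightarrow> nat \<Rightarrow> tensor \<Rightarrow> tensor" where
  "Phi n v k N w = wedge_left n v N k w"

definition Phi_star :: "int \<Rightarrow> tensor \<Rightarrow> tensor" where
  "Phi_star k w = (\<Sum>s\<in>{s. (- k) # s \<in> Poly_Mapping.keys w}.
     scl (Poly_Mapping.lookup w ((- k) # s)) (basis s))"

definition Phi_tilde_star :: "complex \<Rightarrow> int \<Rightarrow> nat \<Rightarrow> tensor \<Rightarrow> tensor" where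
  "Phi_tilde_star v k N w = scl (qnum_plus v N) (Phi_star k w)"

text \<open>
  The first conjunct says that \<open>A N\<close> is, for \<open>N \<ge> 1\<close>, a linear operator from the \<open>N\<close>-th to the
  \<open>N + \<delta>\<close>-th wedge space; it is meant for \<open>\<delta> \<ge> -1\<close>. The bound \<open>l \<le> M\<close> makes \<open>phi n v m N l\<close>
  meaningful for all \<open>N > M\<close>.
\<close>

definition stabilizes :: "nat \<Rightarrow> complex \<Rightarrow> int \<Rightarrow> int \<Rightarrow> (nat \<Rightarrow> tensor \<Rightarrow> tensor) \<Rightarrow> bool" where
  "stabilizes n v m \<delta> A \<longleftrightarrow>
     (\<forall>N\<ge>1. linear_between (Wedge n v N) (Wedge n v (nat (int N + \<delta>))) (A N)) \<and>
     (\<forall>l. \<forall>w\<in>Wedge n v l. \<exists>M\<ge>l. \<forall>N>M. \<forall>r.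
        phi n v (m + \<delta>) (nat (int (N + r) + \<delta>)) (nat (int N + \<delta>)) (A N (phi n v m N l w)) =
        A (N + r) (phi n v m (N + r) l w))"

end

theory Submission
  imports Defs
begin

text \<open>
  On \<open>e\<^sub>p \<otimes> e\<^sub>q\<close> the Hecke generator is a swap up to a factor plus terms \<open>e\<^sub>x \<otimes> e\<^bsub>p+q-x\<^esub>\<close> with \<open>x\<close> between
  \<open>p\<close> and \<open>q\<close>. The Bernstein relations with the variables \<open>Y\<^sub>i\<close> reduce the quadratic and braid relations
  to constants, and Matsumoto's theorem then makes the antisymmetrizer the projection onto the
  common eigenspace of the generators for \<open>u = -1/v\<close>. Hence the two wedge maps are well defined
  and commute, which is the stabilization of \<open>\<Phi>\<^sub>k\<close>.

  For \<open>\<Phi>\<^sup>*\<^sub>k\<close> put \<open>b = N - m\<close> and let \<open>y\<close> be the difference of the two sides for one more wedge factor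
  \<open>e\<^sub>b\<close>. It is antisymmetric, all its indices are at most \<open>b\<close>, and its total degree is bounded below. A
  nonzero antisymmetric tensor contains a strictly decreasing index list, and for large \<open>N\<close> the degree
  forces that list to start with \<open>b\<close>. But the part of \<open>y\<close> with first index \<open>b\<close> vanishes: in
  \<open>w \<and> e\<^sub>b\<close> only the longest coset representative moves \<open>e\<^sub>b\<close> to the front, which determines this part
  up to a diagonal operator, and the powers of \<open>v\<close> match because \<open>[i]\<^sup>+ = v\<^bsup>2i-2\<^esup> [i]\<^sup>-\<close>.
\<close>

subsection \<open>Linear maps on tensors\<close>

text \<open>Why degree forces the first index: wedging \<open>w\<close> from l up to N factors adds
  the e_{j-m} with l \<le> j < N, so every key of the image has degree at least L plus the staircase
  sum of j - m over j < N, where L depends only on \<open>w\<close> and m. Removing e_{-k} and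
  adding e_b with b = N - m gives a tensor with N factors and degree at least L + k + b plus the
  same staircase. A strictly decreasing list of length N that starts at b - 1 or below has degree at
  most (b-1) + (b-2) + ... + (b-N), and this is exactly the staircase. The two bounds clash once L +
  k + b > 0. This inequality persists as b grows, so one M serves all larger N. The given operators
  involve definite descriptions (\<open>divdiff\<close>, the wedge maps) and a chosen reduced word
  (\<open>hecke_perm\<close>). All computations are therefore done with total linear maps,
  \<open>hecke_op\<close>, \<open>hecke_w\<close> and \<open>asum\<close>, that are linked to them
  on \<open>tens N\<close>.\<close>

lemma lookup_scl [simp]: "Poly_Mapping.lookup (scl c x) t = c * Poly_Mapping.lookup x t"
  by (simp add: scl_def Poly_Mapping.map.rep_eq when_def)

lemma lookup_basis: "Poly_Mapping.lookup (basis t) s = (if t = s then 1 else 0)"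
  by (simp add: basis_def lookup_single when_def)

lemma keys_basis [simp]: "Poly_Mapping.keys (basis t) = {t}"
  by (simp add: basis_def)

lemma tensor_eqI: "(\<And>t. Poly_Mapping.lookup x t = Poly_Mapping.lookup y t) \<Longrightarrow> x = (y :: tensor)"
  by (rule poly_mapping_eqI)

lemma lookup_sum_tensor:
  "Poly_Mapping.lookup (\<Sum>i\<in>I. f i) t = (\<Sum>i\<in>I. Poly_Mapping.lookup (f i :: tensor) t)"
  by (rule lookup_sum)

lemma scl_simps [simp]:
  "scl 0 x = 0" "scl 1 x = x" "scl c 0 = 0" "scl c (scl d x) = scl (c * d) x"
  by (auto intro!: tensor_eqI)

lemma scl_distrib:
  "scl c (x + y) = scl c x + scl c y" "scl c (x - y) = scl c x - scl c y"
  "scl (c + d) x = scl c x + scl d x" "scl (c - d) x = scl c x - scl d x"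
  "scl c (- x) = - scl c x" "scl (- c) x = - scl c x"
  by (auto intro!: tensor_eqI simp: lookup_add lookup_minus algebra_simps)

lemma scl_sum: "scl c (\<Sum>i\<in>I. f i) = (\<Sum>i\<in>I. scl c (f i))"
  by (induction I rule: infinite_finite_induct) (auto simp: scl_distrib)

lemma scl_sum_left: "scl (\<Sum>i\<in>I. c i) x = (\<Sum>i\<in>I. scl (c i) x)"
  by (induction I rule: infinite_finite_induct) (auto simp: scl_distrib)

lemma scl_eq_iff: "c \<noteq> 0 \<Longrightarrow> scl c x = y \<longleftrightarrow> x = scl (inverse c) y"
  by auto

definition lin :: "(tensor \<Rightarrow> tensor) \<Rightarrow> bool" where
  "lin f \<longleftrightarrow> (\<forall>x y. f (x + y) = f x + f y) \<and> (\<forall>c x. f (scl c x) = scl c (f x))"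

lemma linI: "(\<And>x y. f (x + y) = f x + f y) \<Longrightarrow> (\<And>c x. f (scl c x) = scl c (f x)) \<Longrightarrow> lin f"
  by (auto simp: lin_def)

lemma
  assumes "lin f"
  shows lin_add: "f (x + y) = f x + f y"
    and lin_scl: "f (scl c x) = scl c (f x)"
    and lin_zero: "f 0 = 0"
    and lin_uminus: "f (- x) = - f x"
    and lin_diff: "f (x - y) = f x - f y"
    and lin_sum: "f (\<Sum>i\<in>I. g i) = (\<Sum>i\<in>I. f (g i))"
proof -
  show add: "f (x + y) = f x + f y" and scl: "f (scl c x) = scl c (f x)" for x y c
    using assms by (auto simp: lin_def)
  show zero: "f 0 = 0" using scl[of 0 0] by simp
  show um: "f (- x) = - f x" for x using scl[of "-1" x] by (simp add: scl_distrib)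
  show "f (x - y) = f x - f y" using add[of x "- y"] um by simp
  show "f (\<Sum>i\<in>I. g i) = (\<Sum>i\<in>I. f (g i))"
    by (induction I rule: infinite_finite_induct) (auto simp: zero add)
qed

lemma lin_comp: "lin f \<Longrightarrow> lin g \<Longrightarrow> lin (\<lambda>x. f (g x))"
  by (auto simp: lin_def)

lemma lookup_lin_ext:
  "Poly_Mapping.lookup (lin_ext f x) s =
    (\<Sum>t\<in>Poly_Mapping.keys x. Poly_Mapping.lookup x t * Poly_Mapping.lookup (f t) s)"
  by (simp add: lin_ext_def lookup_sum_tensor)

lemma lin_ext_superset:
  assumes "finite F" "Poly_Mapping.keys x \<subseteq> F"
  shows "lin_ext f x = (\<Sum>t\<in>F. scl (Poly_Mapping.lookup x t) (f t))"
  unfolding lin_ext_def using assms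
  by (intro sum.mono_neutral_left) (auto simp: in_keys_iff)

lemma lin_lin_ext [simp]: "lin (lin_ext f)"
proof (rule linI)
  fix x y :: tensor and c
  let ?F = "Poly_Mapping.keys x \<union> Poly_Mapping.keys y"
  show "lin_ext f (x + y) = lin_ext f x + lin_ext f y"
    using Poly_Mapping.keys_add[of x y]
    by (simp add: lin_ext_superset[of ?F] lookup_add scl_distrib sum.distrib)
  have "Poly_Mapping.keys (scl c x) \<subseteq> Poly_Mapping.keys x"
    by (auto simp: in_keys_iff)
  then show "lin_ext f (scl c x) = scl c (lin_ext f x)"
    by (simp add: lin_ext_superset[of "Poly_Mapping.keys x"] scl_sum)
qed

lemma lin_ext_basis [simp]: "lin_ext f (basis t) = f t"
  by (simp add: lin_ext_def lookup_basis)

lemma tensor_expand: "x = lin_ext basis x"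
proof (rule tensor_eqI)
  fix t
  have "Poly_Mapping.lookup (lin_ext basis x) t =
    (\<Sum>s\<in>Poly_Mapping.keys x. if s = t then Poly_Mapping.lookup x s else 0)"
    unfolding lookup_lin_ext by (rule sum.cong) (auto simp: lookup_basis)
  then show "Poly_Mapping.lookup x t = Poly_Mapping.lookup (lin_ext basis x) t"
    by (simp add: sum.delta in_keys_iff)
qed

lemma lin_expand: "lin f \<Longrightarrow> f x = lin_ext (\<lambda>t. f (basis t)) x"
  by (subst tensor_expand[of x]) (simp add: lin_ext_def lin_sum lin_scl)

lemma lin_eq_on:
  assumes "lin f" "lin g" "\<And>t. t \<in> Poly_Mapping.keys x \<Longrightarrow> f (basis t) = g (basis t)"
  shows "f x = g x"
  unfolding lin_expand[OF assms(1), of x] lin_expand[OF assms(2), of x] lin_ext_def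
  using assms(3) by (intro sum.cong) auto

definition supp :: "int list set \<Rightarrow> tensor set" where
  "supp A = {x. Poly_Mapping.keys x \<subseteq> A}"

lemma tens_supp: "tens N = supp {t. length t = N}"
  by (simp add: tens_def supp_def)

lemma
  shows supp_zero: "0 \<in> supp A"
    and supp_add: "x \<in> supp A \<Longrightarrow> y \<in> supp A \<Longrightarrow> x + y \<in> supp A"
    and supp_scl: "x \<in> supp A \<Longrightarrow> scl c x \<in> supp A"
    and supp_basis: "basis t \<in> supp A \<longleftrightarrow> t \<in> A"
  using Poly_Mapping.keys_add[of x y] by (auto simp: supp_def in_keys_iff)

lemma supp_diff: "x \<in> supp A \<Longrightarrow> y \<in> supp A \<Longrightarrow> x - y \<in> supp A"
  using supp_add[of x A "scl (-1) y"] supp_scl[of y A "-1"] by (simp add: scl_distrib)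

lemma supp_sum: "(\<And>i. i \<in> I \<Longrightarrow> f i \<in> supp A) \<Longrightarrow> (\<Sum>i\<in>I. f i) \<in> supp A"
  by (induction I rule: infinite_finite_induct) (auto intro: supp_zero supp_add)

lemma supp_lin_ext:
  "x \<in> supp A \<Longrightarrow> (\<And>t. t \<in> A \<Longrightarrow> f t \<in> supp B) \<Longrightarrow> lin_ext f x \<in> supp B"
  unfolding lin_ext_def by (intro supp_sum supp_scl) (auto simp: supp_def)

lemma supp_image:
  "lin f \<Longrightarrow> x \<in> supp A \<Longrightarrow> (\<And>t. t \<in> A \<Longrightarrow> f (basis t) \<in> supp B) \<Longrightarrow> f x \<in> supp B"
  by (subst lin_expand) (auto intro: supp_lin_ext)

lemma lin_eq_supp:
  "lin f \<Longrightarrow> lin g \<Longrightarrow> x \<in> supp A \<Longrightarrow> (\<And>t. t \<in> A \<Longrightarrow> f (basis t) = g (basis t)) \<Longrightarrow> f x = g x"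
  by (rule lin_eq_on) (auto simp: supp_def)

text \<open>Reads off a coefficient to which a single basis vector can contribute. If
  \<open>u\<close> is not a key of \<open>x\<close>, both sides vanish.\<close>

lemma lookup_lin_single:
  assumes "lin f" "\<And>t. t \<in> Poly_Mapping.keys x \<Longrightarrow> t \<noteq> u \<Longrightarrow> Poly_Mapping.lookup (f (basis t)) s = 0"
  shows "Poly_Mapping.lookup (f x) s = Poly_Mapping.lookup x u * Poly_Mapping.lookup (f (basis u)) s"
proof -
  have "Poly_Mapping.lookup (f x) s =
    (\<Sum>t\<in>Poly_Mapping.keys x. if t = u then Poly_Mapping.lookup x u * Poly_Mapping.lookup (f (basis u)) s else 0)"
    unfolding lin_expand[OF assms(1), of x] lookup_lin_ext
    by (rule sum.cong) (use assms(2) in auto)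
  then show ?thesis by (simp add: sum.delta in_keys_iff)
qed

subsection \<open>The action on basis tensors\<close>

text \<open>T_i on e_p \<otimes> e_q with the divided difference summed out. The sum keeps the
  residue of each factor, since the divided difference changes only exponents of Y. An ascent
  retains the endpoint x = p, a descent omits both ends. The coefficient 1/v in a descent with equal
  residues is v - (v - 1/v): there the endpoint x = q of the divided difference is merged into the
  swapped term.\<close>

definition hecke_basis :: "nat \<Rightarrow> complex \<Rightarrow> nat \<Rightarrow> int list \<Rightarrow> tensor" where
  "hecke_basis n v i t = (let p = t ! i; q = t ! Suc i; e = (\<lambda>x. basis (t[i := x, Suc i := p + q - x])) in
     if p \<le> q
     then scl (if int n dvd q - p then v else 1) (e q) +
          scl (v - inverse v) (\<Sum>x | p \<le> x \<and> x < q \<and> int n dvd x - p. e x)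
     else scl (if int n dvd q - p then inverse v else 1) (e q) -
          scl (v - inverse v) (\<Sum>x | q < x \<and> x < p \<and> int n dvd x - p. e x))"

text \<open>Linear on all tensors, free of N and of the definite description in
  \<open>divdiff\<close>; \<open>hecke_eq\<close> identifies it with \<open>hecke\<close> on
  \<open>tens N\<close>.\<close>

definition hecke_op :: "nat \<Rightarrow> complex \<Rightarrow> nat \<Rightarrow> tensor \<Rightarrow> tensor" where
  "hecke_op n v i = lin_ext (hecke_basis n v i)"

lemma lin_hecke_op [simp]: "lin (hecke_op n v i)"
  by (simp add: hecke_op_def)

lemma hecke_op_basis: "hecke_op n v i (basis t) = hecke_basis n v i t"
  by (simp add: hecke_op_def)

lemma hecke_op_update:
  assumes "Suc i < length t"
  shows "hecke_op n v i (basis (t[i := p, Suc i := q])) =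
    (if p \<le> q
     then scl (if int n dvd q - p then v else 1) (basis (t[i := q, Suc i := p])) +
          scl (v - inverse v) (\<Sum>x | p \<le> x \<and> x < q \<and> int n dvd x - p. basis (t[i := x, Suc i := p + q - x]))
     else scl (if int n dvd q - p then inverse v else 1) (basis (t[i := q, Suc i := p])) -
          scl (v - inverse v) (\<Sum>x | q < x \<and> x < p \<and> int n dvd x - p. basis (t[i := x, Suc i := p + q - x])))"
proof -
  have "t[i := p, Suc i := q, i := x, Suc i := y] = t[i := x, Suc i := y]" for x y
    by (simp add: list_update_swap[of "Suc i" i])
  then show ?thesis
    using assms by (simp add: hecke_op_basis hecke_basis_def Let_def nth_list_update)
qed

lemma lin_multY [simp]: "lin (multY n i d)"
  by (simp add: multY_def)

lemma multY_basis [simp]: "multY n i d (basis t) = basis (t[i := t ! i + int n * d])"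
  by (simp add: multY_def)

lemma lin_matunit [simp]: "lin (matunit n i a b)"
  by (simp add: matunit_def)

lemma lin_swapY [simp]: "lin (swapY n i)"
  by (simp add: swapY_def)

lemma lin_const_sum: "(\<And>a. a \<in> I \<Longrightarrow> lin (f a)) \<Longrightarrow> lin (\<lambda>x. \<Sum>a\<in>I. f a x)"
  by (rule linI) (auto simp: lin_def sum.distrib scl_sum intro!: sum.cong)

lemma lin_plus: "lin f \<Longrightarrow> lin g \<Longrightarrow> lin (\<lambda>x. f x + g x)"
  by (rule linI) (auto simp: lin_def scl_distrib algebra_simps)

lemma lin_minus: "lin f \<Longrightarrow> lin g \<Longrightarrow> lin (\<lambda>x. f x - g x)"
  by (rule linI) (auto simp: lin_add lin_scl scl_distrib algebra_simps)

lemma lin_scale: "lin f \<Longrightarrow> lin (\<lambda>x. scl c (f x))"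
  by (rule linI) (auto simp: lin_def scl_distrib mult.commute)

lemma lin_id [simp]: "lin (\<lambda>x. x)"
  by (simp add: lin_def)

lemma lin_Rmat [simp]: "lin (Rmat n v i)"
  unfolding Rmat_def
  by (intro lin_const_sum lin_plus lin_scale lin_comp[OF lin_matunit] lin_matunit)

lemmas lin_intros = lin_const_sum lin_plus lin_minus lin_scale lin_id lin_lin_ext
  lin_comp[OF lin_multY] lin_comp[OF lin_swapY] lin_comp[OF lin_Rmat] lin_comp[OF lin_hecke_op]

section \<open>The R-matrix and the divided difference on basis tensors\<close>

lemma matunit_basis:
  "matunit n i a b (basis t) =
     (if t ! i mod int n = b then basis (t[i := int n * (t ! i div int n) + a]) else 0)"
  by (simp add: matunit_def)

lemma Rmat_basis:
  assumes "n \<ge> 1" "Suc i < length t"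
  defines "a \<equiv> t ! i mod int n" and "b \<equiv> t ! Suc i mod int n"
  shows "Rmat n v i (basis t) =
    (if a = b then scl v (basis t)
     else basis (t[i := int n * (t ! i div int n) + b, Suc i := int n * (t ! Suc i div int n) + a]) +
          (if a < b then scl (v - inverse v) (basis t) else 0))"
proof -
  let ?s = "basis (t[i := int n * (t ! i div int n) + b, Suc i := int n * (t ! Suc i div int n) + a])"
  have ab: "0 \<le> a" "a < int n" "0 \<le> b" "b < int n"
    using assms(1) by (simp_all add: a_def b_def)
  have M: "matunit n i c d (matunit n (Suc i) c' d' (basis t)) =
      (if d = a \<and> d' = b then basis (t[i := int n * (t ! i div int n) + c, Suc i := int n * (t ! Suc i div int n) + c']) else 0)"
    for c d c' d'
    using assms(2) by (auto simp: matunit_basis lin_zero a_def b_def list_update_swap[of "Suc i" i])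
  have t: "t[i := int n * (t ! i div int n) + a, Suc i := int n * (t ! Suc i div int n) + b] = t"
    by (simp add: a_def b_def)
  have "(\<Sum>c\<in>{0..<int n}. matunit n i c c (matunit n (Suc i) c c (basis t))) =
        (\<Sum>c\<in>{0..<int n}. if c = a then (if a = b then basis t else 0) else 0)"
    using t by (intro sum.cong) (auto simp: M)
  also have "\<dots> = (if a = b then basis t else 0)"
    using ab by (simp add: sum.delta)
  finally have 1: "(\<Sum>c\<in>{0..<int n}. matunit n i c c (matunit n (Suc i) c c (basis t))) = \<dots>" .
  have d: "(\<Sum>d\<in>{0..<int n}. \<Sum>c\<in>{0..<d}. if c = x \<and> d = y then z else 0) =
      (if x < y then z else 0)" if "0 \<le> x" "0 \<le> y" "y < int n" for x y and z :: tensor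
  proof -
    have "(\<Sum>d\<in>{0..<int n}. \<Sum>c\<in>{0..<d}. if c = x \<and> d = y then z else 0) =
        (\<Sum>d\<in>{0..<int n}. if d = y then (\<Sum>c\<in>{0..<d}. if c = x then z else 0) else 0)"
      by (intro sum.cong) (auto intro!: sum.neutral)
    also have "\<dots> = (if x < y then z else 0)"
      using that by (simp add: sum.delta)
    finally show ?thesis .
  qed
  have 2: "matunit n i c d (matunit n (Suc i) d c (basis t)) + matunit n i d c (matunit n (Suc i) c d (basis t)) +
        scl (v - inverse v) (matunit n i c c (matunit n (Suc i) d d (basis t))) =
      (if c = b \<and> d = a then ?s else 0) + (if c = a \<and> d = b then ?s else 0) +
      (if c = a \<and> d = b then scl (v - inverse v) (basis t) else 0)" (is "?l = _") for c d
  proof -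
    have "?l = (if c = b \<and> d = a then ?s else 0) + (if c = a \<and> d = b then ?s else 0) +
        (if c = a \<and> d = b then scl (v - inverse v) (basis t) else 0)"
    proof (intro arg_cong2[of _ _ _ _ "(+)"])
      show "matunit n i c d (matunit n (Suc i) d c (basis t)) = (if c = b \<and> d = a then ?s else 0)"
        unfolding M by (intro if_cong) auto
      show "matunit n i d c (matunit n (Suc i) c d (basis t)) = (if c = a \<and> d = b then ?s else 0)"
        unfolding M by (intro if_cong) auto
      show "scl (v - inverse v) (matunit n i c c (matunit n (Suc i) d d (basis t))) =
          (if c = a \<and> d = b then scl (v - inverse v) (basis t) else 0)"
        unfolding M using t by simp
    qed
    then show ?thesis .
  qed
  show ?thesis
    unfolding Rmat_def 1 2 sum.distrib d[OF ab(1,3,4)] d[OF ab(3,1,2)]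
    by (cases a b rule: linorder_cases) (simp_all add: scl_distrib)
qed

text \<open>With z = Y_i/Y_{i+1} the quotient for Y_i^j Y_{i+1}^k is Y_{i+1}^(j+k) (z^k - z^j)/(z -
  1), a geometric sum. The residues stay in place because only the variables are swapped.\<close>

definition divdiff_basis :: "nat \<Rightarrow> nat \<Rightarrow> int list \<Rightarrow> tensor" where
  "divdiff_basis n i t = (let j = t ! i div int n; k = t ! Suc i div int n;
       e = (\<lambda>c. basis (t[i := int n * c + t ! i mod int n, Suc i := int n * (j + k - c) + t ! Suc i mod int n])) in
     if j \<le> k then \<Sum>c\<in>{j..<k}. e c else - (\<Sum>c\<in>{k..<j}. e c))"

lemma sum_telescope_int:
  fixes f :: "int \<Rightarrow> 'a :: ab_group_add"
  assumes "j \<le> k"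
  shows "(\<Sum>c\<in>{j..<k}. f (c + 1) - f c) = f k - f j"
  using assms
proof (induction k rule: int_ge_induct)
  case (step k)
  have "{j..<k + 1} = insert k {j..<k}" using step.hyps by auto
  then show ?case using step.IH by (simp add: algebra_simps)
qed simp

lemma divdiff_basis_eq:
  assumes "Suc i < length t"
  shows "multY n i 1 (multY n (Suc i) (-1) (divdiff_basis n i t)) - divdiff_basis n i t =
    swapY n i (basis t) - basis t"
proof -
  define j k a b where "j = t ! i div int n" and "k = t ! Suc i div int n"
    and "a = t ! i mod int n" and "b = t ! Suc i mod int n"
  define e where "e c = basis (t[i := int n * c + a, Suc i := int n * (j + k - c) + b])" for c
  let ?X = "\<lambda>x. multY n i 1 (multY n (Suc i) (-1) x)"
  have lX: "lin ?X" by (intro lin_intros)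
  have X: "?X (e c) = e (c + 1)" for c
    using assms by (auto simp: e_def nth_list_update list_update_swap[of "Suc i" i] algebra_simps)
  have t: "e j = basis t" "e k = swapY n i (basis t)"
    by (simp_all add: e_def swapY_def j_def k_def a_def b_def)
  have sw: "swapY n i (e j) = e k" using t by simp
  have S: "?X (\<Sum>c\<in>{x..<y}. e c) = e y - e x + (\<Sum>c\<in>{x..<y}. e c)" if "x \<le> y" for x y
    using sum_telescope_int[OF that, of e] by (simp add: lin_sum[OF lX] X sum_subtractf algebra_simps)
  show ?thesis
    unfolding t(1)[symmetric] sw divdiff_basis_def Let_def j_def[symmetric] k_def[symmetric] a_def[symmetric]
      b_def[symmetric] e_def[symmetric]
    by (auto simp: lin_uminus[OF lX] S)
qed

text \<open>A key with the largest entry at position \<open>i\<close> would be moved by Y_i/Y_{i+1}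
  to a key with a still larger entry. This gives the uniqueness demanded by the description in
  \<open>divdiff\<close>.\<close>

lemma multY_inj_zero:
  assumes "n \<ge> 1" "g \<in> tens N" "Suc i < N" "multY n i 1 (multY n (Suc i) (-1) g) = g"
  shows "g = 0"
proof (rule ccontr)
  assume "g \<noteq> 0"
  let ?X = "\<lambda>x. multY n i 1 (multY n (Suc i) (-1) x)"
  let ?f = "\<lambda>t. t[i := t ! i + int n, Suc i := t ! Suc i - int n]"
  have lX: "lin ?X" by (intro lin_intros)
  have Xb: "?X (basis t) = basis (?f t)" if "length t = N" for t
    using that assms(3) by (simp add: list_update_swap[of "Suc i" i])
  have fin: "finite (Poly_Mapping.keys g)" "Poly_Mapping.keys g \<noteq> {}"
    using \<open>g \<noteq> 0\<close> by auto
  obtain t where t: "t \<in> Poly_Mapping.keys g" "\<And>s. s \<in> Poly_Mapping.keys g \<Longrightarrow> s ! i \<le> t ! i"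
  proof -
    have "Max ((\<lambda>t. t ! i) ` Poly_Mapping.keys g) \<in> (\<lambda>t. t ! i) ` Poly_Mapping.keys g"
      using fin by (intro Max_in) auto
    then obtain t where "t \<in> Poly_Mapping.keys g" "Max ((\<lambda>t. t ! i) ` Poly_Mapping.keys g) = t ! i"
      by auto
    then show ?thesis using that fin by (metis Max_ge finite_imageI imageI)
  qed
  have len: "length s = N" if "s \<in> Poly_Mapping.keys g" for s
    using that assms(2) by (auto simp: tens_def)
  have "Poly_Mapping.lookup (?X g) (?f t) = Poly_Mapping.lookup g t * Poly_Mapping.lookup (?X (basis t)) (?f t)"
  proof (rule lookup_lin_single[OF lX])
    fix s assume s: "s \<in> Poly_Mapping.keys g" "s \<noteq> t"
    have "?f s \<noteq> ?f t"
    proof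
      assume eq: "?f s = ?f t"
      have "s ! j = t ! j" if "j < N" for j
        using arg_cong[OF eq, of "\<lambda>u. u ! j"] that len[OF s(1)] len[OF t(1)] assms(3)
        by (auto simp: nth_list_update split: if_splits)
      then show False using s(2) len[OF s(1)] len[OF t(1)] by (auto intro: nth_equalityI)
    qed
    then show "Poly_Mapping.lookup (?X (basis s)) (?f t) = 0"
      using Xb[OF len[OF s(1)]] by (simp add: lookup_basis)
  qed
  also have "\<dots> \<noteq> 0"
    using t(1) Xb[OF len[OF t(1)]] by (simp add: lookup_basis in_keys_iff)
  finally have "?f t \<in> Poly_Mapping.keys g"
    unfolding assms(4) by (simp add: in_keys_iff)
  from t(2)[OF this] show False
    using len[OF t(1)] assms(1,3) by (simp add: nth_list_update)
qed

lemma divdiff_eq: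
  assumes "n \<ge> 1" "x \<in> tens N" "Suc i < N"
  shows "divdiff n N i x = lin_ext (divdiff_basis n i) x"
proof -
  let ?X = "\<lambda>x. multY n i 1 (multY n (Suc i) (-1) x)"
  let ?d = "lin_ext (divdiff_basis n i) x"
  have lX: "lin ?X" by (intro lin_intros)
  have 1: "?d \<in> tens N"
    using assms(2) unfolding tens_supp
    by (rule supp_lin_ext)
       (auto simp: divdiff_basis_def Let_def supp_basis intro!: supp_sum supp_diff[OF supp_zero, simplified])
  have 2: "?X ?d - ?d = swapY n i x - x"
    by (rule lin_eq_supp[of _ _ _ "{t. length t = N}"])
       (use assms in \<open>auto simp: tens_supp divdiff_basis_eq intro!: lin_intros\<close>)
  show ?thesis
    unfolding divdiff_def
  proof (rule the_equality)
    fix g assume g: "g \<in> tens N \<and> ?X g - g = swapY n i x - x"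
    then have "?X g - ?X ?d = g - ?d"
    proof -
      have "?X g - g = ?X ?d - ?d" using g 2 by simp
      then show ?thesis by (simp add: algebra_simps)
    qed
    then have "?X (g - ?d) = g - ?d"
      by (simp only: lin_diff[OF lX])
    moreover have "g - ?d \<in> tens N"
      using g 1 by (auto simp: tens_supp intro: supp_diff)
    ultimately show "g = ?d"
      using multY_inj_zero[OF assms(1) _ assms(3)] by force
  qed (use 1 2 in auto)
qed

lemma div_mod_less_iff:
  fixes n c k a b :: int
  assumes "0 \<le> a" "a < n" "0 \<le> b" "b < n"
  shows "n * c + a < n * k + b \<longleftrightarrow> c < k \<or> c = k \<and> a < b"
proof -
  have "n * c + n \<le> n * k" if "c < k" for c k
    using mult_left_mono[of "c + 1" k n] that assms by (simp add: algebra_simps)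
  then show ?thesis
    using assms by (cases c k rule: linorder_cases) (fastforce+)
qed

lemma hecke_eq_basis:
  assumes n: "n \<ge> 1" and i: "Suc i < length t"
  shows "swapY n i (Rmat n v i (basis t)) + scl (v - inverse v) (divdiff_basis n i t) = hecke_basis n v i t"
proof -
  define p q where "p = t ! i" and "q = t ! Suc i"
  define j k a b where "j = p div int n" and "k = q div int n"
    and "a = p mod int n" and "b = q mod int n"
  define e where "e x = basis (t[i := x, Suc i := p + q - x])" for x
  let ?n = "int n"
  have pq: "p = ?n * j + a" "q = ?n * k + b"
    by (simp_all add: j_def k_def a_def b_def)
  have ab: "0 \<le> a" "a < ?n" "0 \<le> b" "b < ?n"
    using n by (simp_all add: a_def b_def)
  note less = div_mod_less_iff[OF ab] div_mod_less_iff[OF ab(3,4,1,2)]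
    div_mod_less_iff[OF ab(1,2,1,2)]
  have dv: "?n dvd q - p \<longleftrightarrow> a = b"
    unfolding a_def b_def by (metis mod_eq_dvd_iff)
  have D: "divdiff_basis n i t = (if j \<le> k then \<Sum>c\<in>{j..<k}. e (?n * c + a) else - (\<Sum>c\<in>{k..<j}. e (?n * c + a)))"
    unfolding divdiff_basis_def Let_def p_def[symmetric] q_def[symmetric] j_def[symmetric] k_def[symmetric]
      a_def[symmetric] b_def[symmetric] e_def by (simp add: pq algebra_simps)
  have s1: "swapY n i (basis t) = e (?n * k + a)"
    unfolding swapY_def lin_ext_basis p_def[symmetric] q_def[symmetric] j_def[symmetric] k_def[symmetric]
      a_def[symmetric] b_def[symmetric] e_def by (simp add: pq algebra_simps)
  have s2: "swapY n i (basis (t[i := ?n * j + b, Suc i := ?n * k + a])) = e q"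
    using i ab n unfolding swapY_def lin_ext_basis e_def
    by (simp add: nth_list_update list_update_swap[of "Suc i" i] pq)
  have "Rmat n v i (basis t) =
    (if a = b then scl v (basis t)
     else basis (t[i := ?n * j + b, Suc i := ?n * k + a]) +
          (if a < b then scl (v - inverse v) (basis t) else 0))"
    using Rmat_basis[OF n i, of v] by (simp add: p_def q_def a_def b_def j_def k_def)
  then have R: "swapY n i (Rmat n v i (basis t)) =
     (if a = b then scl v (e q) else e q + (if a < b then scl (v - inverse v) (e (?n * k + a)) else 0))"
    using s1 s2 by (auto simp: lin_add lin_scl lin_zero pq)
  have H: "hecke_basis n v i t =
     (if p \<le> q
      then scl (if a = b then v else 1) (e q) + scl (v - inverse v) (\<Sum>x | p \<le> x \<and> x < q \<and> int n dvd x - p. e x)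
      else scl (if a = b then inverse v else 1) (e q) -
          scl (v - inverse v) (\<Sum>x | q < x \<and> x < p \<and> int n dvd x - p. e x))"
    unfolding hecke_basis_def Let_def p_def[symmetric] q_def[symmetric] e_def dv ..
  have inj: "inj_on (\<lambda>c. ?n * c + a) A" for A
    using n by (auto simp: inj_on_def)
  have dvx: "?n dvd x - p \<longleftrightarrow> (\<exists>c. x = ?n * c + a)" for x
  proof
    assume "?n dvd x - p"
    then obtain d where "x - p = ?n * d" ..
    then have "x = ?n * (j + d) + a" by (simp add: pq algebra_simps)
    then show "\<exists>c. x = ?n * c + a" ..
  qed (auto simp: pq algebra_simps right_diff_distrib[symmetric])
  have cmp: "p \<le> ?n * c + a \<longleftrightarrow> j \<le> c" "?n * c + a < p \<longleftrightarrow> c < j"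
      "?n * c + a < q \<longleftrightarrow> c < k \<or> c = k \<and> a < b" "q < ?n * c + a \<longleftrightarrow> k < c \<or> k = c \<and> b < a" for c
    using less(1)[of c k] less(2)[of k c] less(3)[of c j] less(3)[of j c] by (auto simp: pq not_less)
  show ?thesis
  proof (cases "p \<le> q")
    case True
    then have jk: "j < k \<or> j = k \<and> a \<le> b" using less(2)[of k j] pq by auto
    \<comment> \<open>For a < b the term of R at x = n k + a extends the range of the divided
      difference to all admissible x below q.\<close>
    have "{x. p \<le> x \<and> x < q \<and> ?n dvd x - p} = (\<lambda>c. ?n * c + a) ` ({j..<k} \<union> (if a < b then {k} else {}))"
    proof -
      have "{x. p \<le> x \<and> x < q \<and> ?n dvd x - p} =
          (\<lambda>c. ?n * c + a) ` {c. j \<le> c \<and> (c < k \<or> c = k \<and> a < b)}"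
        unfolding dvx using cmp by blast
      also have "{c. j \<le> c \<and> (c < k \<or> c = k \<and> a < b)} = {j..<k} \<union> (if a < b then {k} else {})"
        using jk by auto
      finally show ?thesis .
    qed
    then have "(\<Sum>x | p \<le> x \<and> x < q \<and> ?n dvd x - p. e x) =
        (\<Sum>c\<in>{j..<k} \<union> (if a < b then {k} else {}). e (?n * c + a))"
      by (simp only: sum.reindex[OF inj] o_def)
    also have "\<dots> = (\<Sum>c\<in>{j..<k}. e (?n * c + a)) + (if a < b then e (?n * k + a) else 0)"
      by (subst sum.union_disjoint) auto
    finally show ?thesis
      using True jk unfolding H R D by (auto simp: scl_distrib)
  next
    case False
    then have jk: "k < j \<or> j = k \<and> b < a" using less(2)[of k j] pq by auto
    \<comment> \<open>The endpoint c = k of the divided difference cancels against R if a < b,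
      lowers the coefficient of the swap from v to 1/v if a = b, and is an ordinary term if a >
      b.\<close>
    have "{x. q < x \<and> x < p \<and> ?n dvd x - p} = (\<lambda>c. ?n * c + a) ` ({k..<j} - (if a \<le> b then {k} else {}))"
    proof -
      have "{x. q < x \<and> x < p \<and> ?n dvd x - p} =
          (\<lambda>c. ?n * c + a) ` {c. (k < c \<or> k = c \<and> b < a) \<and> c < j}"
        unfolding dvx using cmp by blast
      also have "{c. (k < c \<or> k = c \<and> b < a) \<and> c < j} = {k..<j} - (if a \<le> b then {k} else {})"
        using jk by auto
      finally show ?thesis .
    qed
    then have "(\<Sum>x | q < x \<and> x < p \<and> ?n dvd x - p. e x) =
        (\<Sum>c\<in>{k..<j} - (if a \<le> b then {k} else {}). e (?n * c + a))"
      by (simp only: sum.reindex[OF inj] o_def)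
    also have "\<dots> = (\<Sum>c\<in>{k..<j}. e (?n * c + a)) - (if a \<le> b then e (?n * k + a) else 0)"
      using jk by (auto simp: sum_diff)
    finally show ?thesis
      using False jk unfolding H R D by (auto simp: scl_distrib pq)
  qed
qed

lemma hecke_eq:
  assumes "n \<ge> 1" "x \<in> tens N" "Suc i < N"
  shows "hecke n v N i x = hecke_op n v i x"
proof -
  have "swapY n i (Rmat n v i x) + scl (v - inverse v) (lin_ext (divdiff_basis n i) x) = hecke_op n v i x"
    by (rule lin_eq_supp[of _ _ _ "{t. length t = N}"])
       (use assms in \<open>auto simp: tens_supp hecke_eq_basis hecke_op_basis intro!: lin_intros\<close>)
  then show ?thesis
    using assms by (simp add: hecke_def divdiff_eq)
qed

text \<open>One coefficient formula for ascents and descents, which turns T_i into a single sum over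
  the interval between p and q.\<close>

definition hcoef :: "nat \<Rightarrow> complex \<Rightarrow> int \<Rightarrow> int \<Rightarrow> int \<Rightarrow> complex" where
  "hcoef n v p q x =
     (if x = q then (if int n dvd q - p then (if p \<le> q then v else inverse v) else 1) else 0) +
     (if p \<le> x \<and> x < q \<and> int n dvd x - p then v - inverse v else 0) -
     (if q < x \<and> x < p \<and> int n dvd x - p then v - inverse v else 0)"

lemma hecke_basis_sum:
  "hecke_basis n v i t = (\<Sum>x\<in>{min (t ! i) (t ! Suc i)..max (t ! i) (t ! Suc i)}.
     scl (hcoef n v (t ! i) (t ! Suc i) x) (basis (t[i := x, Suc i := t ! i + t ! Suc i - x])))"
proof -
  define p q where "p = t ! i" and "q = t ! Suc i"
  define e where "e x = basis (t[i := x, Suc i := p + q - x])" for x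
  let ?I = "{min p q..max p q}" and ?w = "v - inverse v"
  let ?k = "if int n dvd q - p then (if p \<le> q then v else inverse v) else 1"
  have r: "(\<Sum>x | P x. e x) = (\<Sum>x\<in>?I. if P x then e x else 0)" if "\<And>x. P x \<Longrightarrow> x \<in> ?I" for P
    using that by (auto simp: sum.inter_filter[symmetric] intro!: sum.cong)
  have "(\<Sum>x\<in>?I. scl (hcoef n v p q x) (e x)) =
    (\<Sum>x\<in>?I. if x = q then scl ?k (e q) else 0) +
    scl ?w (\<Sum>x\<in>?I. if p \<le> x \<and> x < q \<and> int n dvd x - p then e x else 0) -
    scl ?w (\<Sum>x\<in>?I. if q < x \<and> x < p \<and> int n dvd x - p then e x else 0)"
    unfolding scl_sum sum.distrib[symmetric] sum_subtractf[symmetric]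
    by (rule sum.cong) (simp_all add: hcoef_def scl_distrib)
  also have "(\<Sum>x\<in>?I. if x = q then scl ?k (e q) else 0) = scl ?k (e q)"
    by (simp add: sum.delta)
  also have "(\<Sum>x\<in>?I. if p \<le> x \<and> x < q \<and> int n dvd x - p then e x else 0) =
      (\<Sum>x | p \<le> x \<and> x < q \<and> int n dvd x - p. e x)"
    by (rule r[symmetric]) auto
  also have "(\<Sum>x\<in>?I. if q < x \<and> x < p \<and> int n dvd x - p then e x else 0) =
      (\<Sum>x | q < x \<and> x < p \<and> int n dvd x - p. e x)"
    by (rule r[symmetric]) auto
  also have "scl ?k (e q) + scl ?w (\<Sum>x | p \<le> x \<and> x < q \<and> int n dvd x - p. e x) -
      scl ?w (\<Sum>x | q < x \<and> x < p \<and> int n dvd x - p. e x) = hecke_basis n v i t"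
  proof (cases "p \<le> q")
    case True
    then have E: "{x. q < x \<and> x < p \<and> int n dvd x - p} = {}" by auto
    show ?thesis using True
      by (simp add: hecke_basis_def Let_def p_def[symmetric] q_def[symmetric] e_def E)
  next
    case False
    then have E: "{x. p \<le> x \<and> x < q \<and> int n dvd x - p} = {}" by auto
    show ?thesis using False
      by (simp add: hecke_basis_def Let_def p_def[symmetric] q_def[symmetric] e_def E)
  qed
  finally show ?thesis unfolding p_def q_def e_def by simp
qed

text \<open>By \<open>hecke_basis_sum\<close> a key changes only by replacing neighbours p, q by y,
  p + q - y with y between them. Supports are therefore controlled by sets closed under this move:
  lists of fixed length here, \<open>bounded_keys\<close> later.\<close>

lemma supp_hecke_op:
  assumes "x \<in> supp A"
    and "\<And>t y. t \<in> A \<Longrightarrow> min (t ! i) (t ! Suc i) \<le> y \<Longrightarrow> y \<le> max (t ! i) (t ! Suc i) \<Longrightarrow>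
           t[i := y, Suc i := t ! i + t ! Suc i - y] \<in> A"
  shows "hecke_op n v i x \<in> supp A"
  by (rule supp_image[OF _ assms(1)])
     (auto simp: hecke_op_basis hecke_basis_sum supp_basis simp del: min_le_iff_disj le_max_iff_disj
       intro!: supp_sum supp_scl assms(2))

lemma tens_hecke_op [simp]: "x \<in> tens N \<Longrightarrow> hecke_op n v i x \<in> tens N"
  unfolding tens_supp by (rule supp_hecke_op) auto

lemma tens_multY [simp]: "x \<in> tens N \<Longrightarrow> multY n i d x \<in> tens N"
  unfolding tens_supp by (rule supp_image[OF lin_multY]) (auto simp: supp_basis)

lemma tens_closed [simp]:
  "x \<in> tens N \<Longrightarrow> scl c x \<in> tens N" "x \<in> tens N \<Longrightarrow> y \<in> tens N \<Longrightarrow> x + y \<in> tens N"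
  "x \<in> tens N \<Longrightarrow> y \<in> tens N \<Longrightarrow> x - y \<in> tens N" "basis t \<in> tens N \<longleftrightarrow> length t = N" "0 \<in> tens N"
  unfolding tens_supp by (auto intro: supp_scl supp_add supp_diff supp_zero simp: supp_basis)

lemma tens_eqI:
  assumes "x \<in> tens N" "lin f" "lin g" "\<And>t. length t = N \<Longrightarrow> f (basis t) = g (basis t)"
  shows "f x = g x"
  using lin_eq_supp[OF assms(2,3), of x "{t. length t = N}"] assms(1,4) by (auto simp: tens_supp)

lemma hecke_op_commute:
  assumes "x \<in> tens N" "Suc i < N" "Suc j < N" "Suc i < j"
  shows "hecke_op n v i (hecke_op n v j x) = hecke_op n v j (hecke_op n v i x)"
proof (rule tens_eqI[OF assms(1)])
  fix t :: "int list" assume t: "length t = N"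
  have sw: "t[j := x, Suc j := y, i := x', Suc i := y'] = t[i := x', Suc i := y', j := x, Suc j := y]"
    for x y x' y'
    using assms by (simp add: list_update_swap[of j i] list_update_swap[of j "Suc i"]
      list_update_swap[of "Suc j" i] list_update_swap[of "Suc j" "Suc i"])
  show "hecke_op n v i (hecke_op n v j (basis t)) = hecke_op n v j (hecke_op n v i (basis t))"
    using assms t
    by (simp add: hecke_op_basis hecke_basis_sum lin_sum[OF lin_hecke_op] lin_scl[OF lin_hecke_op] scl_sum sw mult.commute)
       (rule sum.swap)
qed (auto intro!: lin_intros)

section \<open>Bernstein relations\<close>

lemma dvd_gap:
  assumes "int n dvd x - p" "p < x"
  shows "p + int n \<le> x"
  using zdvd_imp_le[OF assms(1)] assms(2) by simp

text \<open>With the quadratic relation this reads T_i Y_i T_i = Y_{i+1}. Raising p by n moves one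
  end of the summation range by one step: a long ascent loses the term x = p, a descent gains it,
  and the subtracted multiple of e_p \<otimes> e_q accounts for this. If p < q < p + n, the ascent
  becomes a descent with empty sum, and the subtraction removes the only term of the old
  sum.\<close>

lemma hecke_op_multY_fst_basis:
  assumes n: "n \<ge> 1" and v: "v \<noteq> 0" and i: "Suc i < length t"
  shows "hecke_op n v i (multY n i 1 (basis t)) =
    multY n (Suc i) 1 (hecke_op n v i (basis t) - scl (v - inverse v) (basis t))"
proof -
  define p q where "p = t ! i" and "q = t ! Suc i"
  define e where "e x y = basis (t[i := x, Suc i := y])" for x y
  let ?n = "int n" and ?w = "v - inverse v"
  have Y: "multY n i 1 (basis t) = e (p + ?n) q" "basis t = e p q"
    using list_update_id[of "t[i := p + ?n]" "Suc i"] by (simp_all add: e_def p_def q_def)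
  have Ye: "multY n (Suc i) 1 (e x y) = e x (y + ?n)" for x y
    using i by (simp add: e_def)
  note H = hecke_op_update[OF i, of n v, folded e_def]
  note lY = lin_add[OF lin_multY] lin_diff[OF lin_multY] lin_scl[OF lin_multY] lin_sum[OF lin_multY]
  have dv: "?n dvd x - (p + ?n) \<longleftrightarrow> ?n dvd x - p" for x
    using dvd_add_right_iff[of ?n "- ?n" "x - p"] by (simp add: algebra_simps)
  have gap: "p + ?n \<le> x" if "?n dvd x - p" "p < x" for x
    using dvd_gap that .
  consider "p < q" "p + ?n \<le> q" | "p < q" "q < p + ?n" | "p = q" | "q < p" by linarith
  then have "hecke_op n v i (e (p + ?n) q) = multY n (Suc i) 1 (hecke_op n v i (e p q) - scl ?w (e p q))"
  proof cases
    case 1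
    have "{x. p \<le> x \<and> x < q \<and> ?n dvd x - p} = insert p {x. p + ?n \<le> x \<and> x < q \<and> ?n dvd x - p}"
      using 1 n gap by force
    moreover have "finite {x. p + ?n \<le> x \<and> x < q \<and> ?n dvd x - p}"
      by (rule finite_subset[of _ "{p..q}"]) (use 1 n in auto)
    ultimately have "(\<Sum>x | p \<le> x \<and> x < q \<and> ?n dvd x - p. e x (p + ?n + q - x)) =
        e p (q + ?n) + (\<Sum>x | p + ?n \<le> x \<and> x < q \<and> ?n dvd x - p. e x (p + ?n + q - x))"
      using n by (simp add: algebra_simps)
    then show ?thesis using 1
      by (simp add: H dv lY Ye scl_distrib) (simp add: algebra_simps scl_distrib)
  next
    case 2
    have nd: "\<not> ?n dvd q - p" using gap[of q] 2 by auto
    have 1: "{x. p \<le> x \<and> x < q \<and> ?n dvd x - p} = {p}" using 2 gap by force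
    have 3: "{x. q < x \<and> x < p + ?n \<and> ?n dvd x - p} = {}" using 2 gap by force
    show ?thesis using 2 nd by (simp add: H dv lY Ye 1 3)
  next
    case 3
    have 1: "{x. q < x \<and> x < p + ?n \<and> ?n dvd x - p} = {}" using 3 gap by force
    have 2: "{x. p \<le> x \<and> x < q \<and> ?n dvd x - p} = {}" using 3 by force
    show ?thesis unfolding 3 using n
      by (simp add: H dv[unfolded 3] lY Ye 1[unfolded 3] 2[unfolded 3] scl_distrib)
  next
    case 4
    have "{x. q < x \<and> x < p + ?n \<and> ?n dvd x - p} = insert p {x. q < x \<and> x < p \<and> ?n dvd x - p}"
      using 4 n gap by force
    moreover have "finite {x. q < x \<and> x < p \<and> ?n dvd x - p}"
      by (rule finite_subset[of _ "{q..p}"]) auto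
    ultimately have "(\<Sum>x | q < x \<and> x < p + ?n \<and> ?n dvd x - p. e x (p + ?n + q - x)) =
        e p (q + ?n) + (\<Sum>x | q < x \<and> x < p \<and> ?n dvd x - p. e x (p + ?n + q - x))"
      by (simp add: algebra_simps)
    then show ?thesis using 4 n
      by (simp add: H dv lY Ye scl_distrib) (simp add: algebra_simps scl_distrib dvd_diff_commute)
  qed
  then show ?thesis using Y by simp
qed

text \<open>The same boundary term, seen in the second variable. Multiplication by Y_i moves the
  summation index by n, so the sums are compared after the substitution
  \<open>shift\<close>.\<close>

lemma hecke_op_multY_snd_basis:
  assumes n: "n \<ge> 1" and v: "v \<noteq> 0" and i: "Suc i < length t"
  shows "hecke_op n v i (multY n (Suc i) 1 (basis t)) =
    multY n i 1 (hecke_op n v i (basis t)) + scl (v - inverse v) (multY n (Suc i) 1 (basis t))"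
proof -
  define p q where "p = t ! i" and "q = t ! Suc i"
  define e where "e x y = basis (t[i := x, Suc i := y])" for x y
  let ?n = "int n" and ?w = "v - inverse v"
  have Y: "multY n (Suc i) 1 (basis t) = e p (q + ?n)" "basis t = e p q"
    by (simp_all add: e_def p_def q_def)
  have Ye: "multY n i 1 (e x y) = e (x + ?n) y" for x y
    using i by (simp add: e_def list_update_swap[of "Suc i" i])
  note H = hecke_op_update[OF i, of n v, folded e_def]
  note lY = lin_add[OF lin_multY] lin_diff[OF lin_multY] lin_scl[OF lin_multY] lin_sum[OF lin_multY]
  have dv: "?n dvd x - ?n - p \<longleftrightarrow> ?n dvd x - p" for x
    using dvd_add_right_iff[of ?n "- ?n" "x - p"] by (simp add: algebra_simps)
  have dvq: "?n dvd q + ?n - p \<longleftrightarrow> ?n dvd q - p"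
    using dv[of "q + ?n"] by simp
  have gap: "p + ?n \<le> x" if "?n dvd x - p" "p < x" for x
    using dvd_gap that .
  have gap': "x + ?n \<le> p" if "?n dvd x - p" "x < p" for x
    using dvd_gap[of n p x] that by (simp add: dvd_diff_commute)
  have shift: "(\<Sum>x | P x. e (x + ?n) (p + q - x)) = (\<Sum>x | P (x - ?n). e x (p + q + ?n - x))" for P
    by (rule sum.reindex_bij_witness[of _ "\<lambda>x. x - ?n" "\<lambda>x. x + ?n"]) (auto simp: algebra_simps)
  consider "p \<le> q" | "q < p" "p < q + ?n" | "p = q + ?n" | "q + ?n < p" by linarith
  then have "hecke_op n v i (e p (q + ?n)) = multY n i 1 (hecke_op n v i (e p q)) + scl ?w (e p (q + ?n))"
  proof cases
    case 1
    have "{x. p \<le> x \<and> x < q + ?n \<and> ?n dvd x - p} =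
        insert p {x. p \<le> x - ?n \<and> x - ?n < q \<and> ?n dvd x - ?n - p}"
      unfolding dv using 1 n gap by force
    moreover have "finite {x. p \<le> x - ?n \<and> x - ?n < q \<and> ?n dvd x - ?n - p}"
      by (rule finite_subset[of _ "{p..q + ?n}"]) (use 1 n in auto)
    ultimately have "(\<Sum>x | p \<le> x \<and> x < q + ?n \<and> ?n dvd x - p. e x (p + q + ?n - x)) =
        e p (q + ?n) + (\<Sum>x | p \<le> x \<and> x < q \<and> ?n dvd x - p. e (x + ?n) (p + q - x))"
      unfolding shift[of "\<lambda>x. p \<le> x \<and> x < q \<and> ?n dvd x - p"] using n by (simp add: algebra_simps)
    then show ?thesis using 1 n
      by (simp add: H dvq lY Ye scl_distrib) (simp add: algebra_simps scl_distrib)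
  next
    case 2
    have nd: "\<not> ?n dvd q - p" using gap'[of q] 2 by auto
    have 1: "{x. q < x \<and> x < p \<and> ?n dvd x - p} = {}" using 2 gap' by force
    have 3: "{x. p \<le> x \<and> x < q + ?n \<and> ?n dvd x - p} = {p}" using 2 gap by force
    show ?thesis using 2 nd by (simp add: H dvq lY Ye 1 3)
  next
    case 3
    have 1: "{x. q < x \<and> x < p \<and> ?n dvd x - p} = {}" using 3 gap' by force
    have 2: "{x. p \<le> x \<and> x < q + ?n \<and> ?n dvd x - p} = {}" using 3 by force
    show ?thesis using 3 n by (simp add: H dvq lY Ye 1 2) (simp add: 1[unfolded 3] 2[unfolded 3] scl_distrib)
  next
    case 4
    have "{x. q < x - ?n \<and> x - ?n < p \<and> ?n dvd x - ?n - p} =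
        insert p {x. q + ?n < x \<and> x < p \<and> ?n dvd x - p}"
      unfolding dv using 4 n gap by force
    moreover have "finite {x. q + ?n < x \<and> x < p \<and> ?n dvd x - p}"
      by (rule finite_subset[of _ "{q..p}"]) (use 4 n in auto)
    ultimately have "(\<Sum>x | q < x \<and> x < p \<and> ?n dvd x - p. e (x + ?n) (p + q - x)) =
        e p (q + ?n) + (\<Sum>x | q + ?n < x \<and> x < p \<and> ?n dvd x - p. e x (p + q + ?n - x))"
      unfolding shift[of "\<lambda>x. q < x \<and> x < p \<and> ?n dvd x - p"] using n by (simp add: algebra_simps)
    then show ?thesis using 4 n
      by (simp add: H dvq lY Ye scl_distrib) (simp add: algebra_simps scl_distrib)
  qed
  then show ?thesis using Y by simp
qed

subsection \<open>Hecke relations\<close>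

lemma hecke_op_multY_fst:
  assumes "n \<ge> 1" "v \<noteq> 0" "Suc i < N" "x \<in> tens N"
  shows "hecke_op n v i (multY n i 1 x) =
    multY n (Suc i) 1 (hecke_op n v i x - scl (v - inverse v) x)"
  by (rule tens_eqI[OF assms(4)])
     (use assms in \<open>auto simp: hecke_op_multY_fst_basis simp del: multY_basis intro!: lin_intros\<close>)

lemma hecke_op_multY_snd:
  assumes "n \<ge> 1" "v \<noteq> 0" "Suc i < N" "x \<in> tens N"
  shows "hecke_op n v i (multY n (Suc i) 1 x) =
    multY n i 1 (hecke_op n v i x) + scl (v - inverse v) (multY n (Suc i) 1 x)"
  by (rule tens_eqI[OF assms(4)])
     (use assms in \<open>auto simp: hecke_op_multY_snd_basis simp del: multY_basis intro!: lin_intros\<close>)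

lemma hecke_op_multY_other:
  assumes "j \<noteq> i" "j \<noteq> Suc i" "x \<in> tens N"
  shows "hecke_op n v i (multY n j d x) = multY n j d (hecke_op n v i x)"
proof (rule tens_eqI[OF assms(3)])
  fix t :: "int list"
  have "t[i := x, Suc i := y, j := z] = t[j := z, i := x, Suc i := y]" for x y z
    using assms by (simp add: list_update_swap[of j i] list_update_swap[of j "Suc i"])
  then show "hecke_op n v i (multY n j d (basis t)) = multY n j d (hecke_op n v i (basis t))"
    using assms by (simp add: hecke_op_basis hecke_basis_sum lin_sum[OF lin_multY] lin_scl[OF lin_multY])
qed (auto intro!: lin_intros)

lemma multY_inverse:
  assumes "x \<in> tens N" "i < N" "d + e = 0"
  shows "multY n i d (multY n i e x) = x"
proof (rule tens_eqI[OF assms(1)])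
  fix t :: "int list" assume "length t = N"
  then show "multY n i d (multY n i e (basis t)) = basis t"
    using assms by (simp add: eq_neg_iff_add_eq_0[symmetric])
qed (auto intro!: lin_intros)

lemma multY_eq_zero:
  assumes "x \<in> tens N" "i < N" "multY n i 1 x = 0"
  shows "x = 0"
  using multY_inverse[OF assms(1,2), of "-1" 1 n] assms(3) by (simp add: lin_zero)

text \<open>Converts invariance under multiplication by Y_j into a reduction to indices between 0
  and n - 1.\<close>

lemma shift_invariant:
  assumes "\<And>t. length t = N \<Longrightarrow> P (t[j := t ! j + int n]) \<longleftrightarrow> P t"
    and "length t = N" "j < N"
  shows "P t \<longleftrightarrow> P (t[j := t ! j mod int n])"
proof -
  let ?t = "\<lambda>d. t[j := t ! j mod int n + int n * d]"
  have step: "P (?t (d + 1)) \<longleftrightarrow> P (?t d)" for d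
    using assms(1)[of "?t d"] assms(2,3) by (simp add: algebra_simps)
  have "P (?t d) \<longleftrightarrow> P (?t 0)" for d
  proof (induction d rule: int_induct[where k = 0])
    case (step2 d)
    then show ?case using step[of "d - 1"] by simp
  qed (use step in auto)
  from this[of "t ! j div int n"] show ?thesis by simp
qed

text \<open>Among constants the divided difference vanishes and the swap of variables is trivial, so
  T_i is the matrix R itself.\<close>

lemma hecke_op_const:
  assumes "Suc i < length t" "0 \<le> p" "p < int n" "0 \<le> q" "q < int n"
  shows "hecke_op n v i (basis (t[i := p, Suc i := q])) =
    (if p = q then scl v (basis (t[i := q, Suc i := p]))
     else if p < q then basis (t[i := q, Suc i := p]) + scl (v - inverse v) (basis (t[i := p, Suc i := q]))
     else basis (t[i := q, Suc i := p]))"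
proof -
  have d: "int n dvd x - y \<longleftrightarrow> x = y" if "0 \<le> x" "x < int n" "0 \<le> y" "y < int n" for x y
    using dvd_gap[of n x y] dvd_gap[of n y x] that
    by (cases x y rule: linorder_cases) (auto simp: dvd_diff_commute)
  have 1: "{x. p \<le> x \<and> x < q \<and> int n dvd x - p} = (if p < q then {p} else {})"
    using assms d[of _ p] by auto
  have 2: "{x. q < x \<and> x < p \<and> int n dvd x - p} = {}"
    using assms d[of _ p] by auto
  have 3: "{x. q \<le> x \<and> x < q \<and> int n dvd x - q} = {}"
    by auto
  show ?thesis
    using assms by (auto simp: hecke_op_update 1 2 3 d)
qed

text \<open>By the Bernstein relations the defect \<open>Q\<close> commutes with Y_i and Y_{i+1},
  which are injective, so its vanishing can be tested on constants.\<close>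

lemma hecke_op_quadratic:
  assumes n: "n \<ge> 1" and v: "v \<noteq> 0" and i: "Suc i < N" and x: "x \<in> tens N"
  shows "hecke_op n v i (hecke_op n v i x) = scl (v - inverse v) (hecke_op n v i x) + x"
proof -
  let ?T = "hecke_op n v i" and ?w = "v - inverse v"
  define Q where "Q x = ?T (?T x) - scl ?w (?T x) - x" for x
  note lT = lin_add[OF lin_hecke_op] lin_diff[OF lin_hecke_op] lin_scl[OF lin_hecke_op]
  note lY = lin_add[OF lin_multY] lin_diff[OF lin_multY] lin_scl[OF lin_multY]
  note B1 = hecke_op_multY_fst[OF n v i] and B2 = hecke_op_multY_snd[OF n v i]
  have Q1: "Q (multY n i 1 x) = multY n i 1 (Q x)" if "x \<in> tens N" for x
    using that by (simp add: Q_def B1 B2 lT lY scl_distrib algebra_simps)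
  have Q2: "Q (multY n (Suc i) 1 x) = multY n (Suc i) 1 (Q x)" if "x \<in> tens N" for x
    using that by (simp add: Q_def B1 B2 lT lY scl_distrib algebra_simps)
  have lQ: "lin Q" unfolding Q_def by (intro lin_intros)
  have tQ: "Q x \<in> tens N" if "x \<in> tens N" for x
    using that by (simp add: Q_def)
  have "Q (basis t) = 0" if t: "length t = N" for t
  proof -
    let ?P = "\<lambda>t. Q (basis t) = 0"
    have P: "?P (t[j := t ! j + int n]) \<longleftrightarrow> ?P t" if "length t = N" "j \<in> {i, Suc i}" for t j
      using Q1[of "basis t"] Q2[of "basis t"] multY_eq_zero[OF tQ[of "basis t"], of j n] that i
      by (auto simp: lin_zero)
    have S: "?P t \<longleftrightarrow> ?P (t[j := t ! j mod int n])" if "length t = N" "j \<in> {i, Suc i}" for t j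
      by (rule shift_invariant[where P = ?P and N = N and j = j]) (use P that i in auto)
    define p q where "p = t ! i mod int n" and "q = t ! Suc i mod int n"
    have pq: "0 \<le> p" "p < int n" "0 \<le> q" "q < int n"
      using n by (auto simp: p_def q_def)
    have "?P t \<longleftrightarrow> ?P (t[i := p])"
      using S[of t i] t by (simp add: p_def)
    also have "\<dots> \<longleftrightarrow> ?P (t[i := p, Suc i := q])"
      using S[of "t[i := p]" "Suc i"] t i
      by (simp add: q_def)
    also have "Q (basis (t[i := p, Suc i := q])) = 0"
      using pq i t v by (cases p q rule: linorder_cases)
        (simp_all add: Q_def hecke_op_const lT, simp_all add: scl_distrib algebra_simps)
    finally show ?thesis by simp
  qed
  then have "Q x = (\<lambda>_. 0) x"
    by (intro tens_eqI[OF x lQ]) (auto intro: linI)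
  then show ?thesis by (simp add: Q_def algebra_simps)
qed

text \<open>
  The defect \<open>B\<close> of the braid relation satisfies \<open>B T\<^sub>i = (v - v\<^sup>-\<^sup>1 - T\<^sub>j) B\<close> and \<open>B Y\<^sub>3 = Y\<^sub>1 B\<close>. Hence its
  kernel is stable under all \<open>T\<^sub>i\<close> and \<open>Y\<^sub>j\<close>, and constants suffice.
\<close>

lemma hecke_op_braid:
  assumes n: "n \<ge> 1" and v: "v \<noteq> 0" and i: "Suc (Suc i) < N" and x: "x \<in> tens N"
  shows "hecke_op n v i (hecke_op n v (Suc i) (hecke_op n v i x)) =
    hecke_op n v (Suc i) (hecke_op n v i (hecke_op n v (Suc i) x))"
proof -
  let ?w = "v - inverse v"
  define T1 T2 where "T1 = hecke_op n v i" and "T2 = hecke_op n v (Suc i)"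
  define Y1 Y2 Y3 where "Y1 = multY n i 1" and "Y2 = multY n (Suc i) 1" and "Y3 = multY n (Suc (Suc i)) 1"
  define B where "B x = T1 (T2 (T1 x)) - T2 (T1 (T2 x))" for x
  have l: "lin T1" "lin T2" "lin Y1" "lin Y2" "lin Y3"
    by (simp_all add: T1_def T2_def Y1_def Y2_def Y3_def)
  have lB: "lin B" unfolding B_def T1_def T2_def by (intro lin_intros)
  note L = l[THEN lin_add] l[THEN lin_diff] l[THEN lin_scl]
  have c [simp]: "T1 x \<in> tens N" "T2 x \<in> tens N" "Y1 x \<in> tens N" "Y2 x \<in> tens N" "Y3 x \<in> tens N"
    if "x \<in> tens N" for x
    using that by (simp_all add: T1_def T2_def Y1_def Y2_def Y3_def)
  have Q: "T1 (T1 x) = scl ?w (T1 x) + x" "T2 (T2 x) = scl ?w (T2 x) + x" if "x \<in> tens N" for x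
    using hecke_op_quadratic[OF n v _ that] i by (simp_all add: T1_def T2_def)
  have R: "T1 (Y1 x) = Y2 (T1 x - scl ?w x)" "T1 (Y2 x) = Y1 (T1 x) + scl ?w (Y2 x)" "T1 (Y3 x) = Y3 (T1 x)"
       "T2 (Y2 x) = Y3 (T2 x - scl ?w x)" "T2 (Y3 x) = Y2 (T2 x) + scl ?w (Y3 x)" "T2 (Y1 x) = Y1 (T2 x)"
    if "x \<in> tens N" for x
    using i that hecke_op_multY_fst[OF n v _ that] hecke_op_multY_snd[OF n v _ that]
    by (simp_all add: T1_def T2_def Y1_def Y2_def Y3_def hecke_op_multY_other)
  have BT1: "B (T1 x) = scl ?w (B x) - T2 (B x)" and BT2: "B (T2 x) = scl ?w (B x) - T1 (B x)"
    and BY3: "B (Y3 x) = Y1 (B x)" if "x \<in> tens N" for x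
    using that by (simp_all add: B_def Q R L) (simp_all add: scl_distrib algebra_simps)
  define K where "K = {x \<in> tens N. B x = 0}"
  have K_lin: "scl a x \<in> K" "x + y \<in> K" "x - y \<in> K" if "x \<in> K" "y \<in> K" for x y a
    using that by (simp_all add: K_def lin_add[OF lB] lin_diff[OF lB] lin_scl[OF lB])
  have K_T: "T1 x \<in> K" "T2 x \<in> K" if "x \<in> K" for x
    using that l by (simp_all add: K_def BT1 BT2 lin_zero)
  have K_T': "T1 x - scl ?w x \<in> K" "T2 x - scl ?w x \<in> K" if "x \<in> K" for x
    using that by (simp_all add: K_T K_lin)
  have inv: "T1 (T1 x - scl ?w x) = x" "T2 (T2 x - scl ?w x) = x" if "x \<in> tens N" for x
    using that by (simp_all add: Q L)
  have Bt: "B x \<in> tens N" if "x \<in> tens N" for x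
    using that by (simp add: B_def)
  have K3: "Y3 x \<in> K \<longleftrightarrow> x \<in> K" if "x \<in> tens N" for x
    using that l multY_eq_zero[OF Bt[OF that], of i n] i by (auto simp: K_def BY3 Y1_def lin_zero)
  \<comment> \<open>The Bernstein relation says Y2 = T2^(-1) Y3 T2^(-1), and \<open>K\<close> is
    stable under T2 and its inverse T2 - (v - 1/v). So invariance under Y3 passes to Y2, and in the
    same way through T1 to Y1.\<close>
  have K2: "Y2 x \<in> K \<longleftrightarrow> x \<in> K" if x: "x \<in> tens N" for x
  proof
    assume "Y2 x \<in> K"
    then have "Y3 (T2 x - scl ?w x) \<in> K" using K_T(2) R(4)[OF x] by metis
    then have "T2 x - scl ?w x \<in> K" using x by (simp add: K3)
    then show "x \<in> K" using K_T(2) inv(2)[OF x] by metis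
  next
    assume "x \<in> K"
    then have "Y3 (T2 x - scl ?w x) \<in> K" using K_T'(2) x by (simp add: K3)
    then have "T2 (T2 (Y2 x)) - scl ?w (T2 (Y2 x)) \<in> K"
      unfolding R(4)[OF x, symmetric] by (rule K_T')
    then show "Y2 x \<in> K" using x by (simp add: Q)
  qed
  have K1: "Y1 x \<in> K \<longleftrightarrow> x \<in> K" if x: "x \<in> tens N" for x
  proof
    assume "Y1 x \<in> K"
    then have "Y2 (T1 x - scl ?w x) \<in> K" using K_T(1) R(1)[OF x] by metis
    then have "T1 x - scl ?w x \<in> K" using x by (simp add: K2)
    then show "x \<in> K" using K_T(1) inv(1)[OF x] by metis
  next
    assume "x \<in> K"
    then have "Y2 (T1 x - scl ?w x) \<in> K" using K_T'(1) x by (simp add: K2)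
    then have "T1 (T1 (Y1 x)) - scl ?w (T1 (Y1 x)) \<in> K"
      unfolding R(1)[OF x, symmetric] by (rule K_T')
    then show "Y1 x \<in> K" using x by (simp add: Q)
  qed
  have "B (basis t) = 0" if t: "length t = N" for t
  proof -
    let ?P = "\<lambda>t. basis t \<in> K"
    have P: "?P (t[j := t ! j + int n]) \<longleftrightarrow> ?P t" if "length t = N" "j \<in> {i, Suc i, Suc (Suc i)}" for t j
      using K1[of "basis t"] K2[of "basis t"] K3[of "basis t"] that by (auto simp: Y1_def Y2_def Y3_def)
    have S: "?P t \<longleftrightarrow> ?P (t[j := t ! j mod int n])" if "length t = N" "j \<in> {i, Suc i, Suc (Suc i)}" for t j
      by (rule shift_invariant[where P = ?P and N = N and j = j]) (use P that i in auto)
    define p q r where "p = t ! i mod int n" and "q = t ! Suc i mod int n" and "r = t ! Suc (Suc i) mod int n"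
    have pqr: "0 \<le> p" "p < int n" "0 \<le> q" "q < int n" "0 \<le> r" "r < int n"
      using n by (auto simp: p_def q_def r_def)
    define e where "e a b c = basis (t[i := a, Suc i := b, Suc (Suc i) := c])" for a b c
    have T1e: "T1 (e a b c) = (if a = b then scl v (e b a c) else if a < b then e b a c + scl ?w (e a b c) else e b a c)"
      if "0 \<le> a" "a < int n" "0 \<le> b" "b < int n" for a b c
    proof -
      have "t[i := a, Suc i := b, Suc (Suc i) := c] = t[Suc (Suc i) := c, i := a, Suc i := b]" for a b c
        by (simp add: list_update_swap[of "Suc (Suc i)" i] list_update_swap[of "Suc (Suc i)" "Suc i"])
      then show ?thesis unfolding e_def T1_def using that i t by (simp add: hecke_op_const)
    qed
    have T2e: "T2 (e a b c) = (if b = c then scl v (e a c b) else if b < c then e a c b + scl ?w (e a b c) else e a c b)"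
      if "0 \<le> b" "b < int n" "0 \<le> c" "c < int n" for a b c
      unfolding e_def T2_def using that i t by (simp add: hecke_op_const)
    have "?P t \<longleftrightarrow> ?P (t[i := p])"
      using S[of t i] t by (simp add: p_def)
    also have "\<dots> \<longleftrightarrow> ?P (t[i := p, Suc i := q])"
      using S[of "t[i := p]" "Suc i"] t i
      by (simp add: q_def)
    also have "\<dots> \<longleftrightarrow> e p q r \<in> K"
      using S[of "t[i := p, Suc i := q]" "Suc (Suc i)"] t i
      by (simp add: r_def e_def)
    finally have iff: "?P t \<longleftrightarrow> e p q r \<in> K" .
    have vv: "v * (inverse v * inverse v) = inverse v" "v * (v * inverse v) = v"
      using v by simp_all
    have "B (e p q r) = 0"
      using pqr unfolding B_def
      by (cases p q rule: linorder_cases; cases q r rule: linorder_cases; cases p r rule: linorder_cases)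
         (simp_all add: T1e T2e L, simp_all add: scl_distrib algebra_simps vv)
    then have "e p q r \<in> K" using t by (simp add: K_def e_def)
    then show ?thesis using iff by (simp add: K_def)
  qed
  then have "B x = (\<lambda>_. 0) x"
    by (intro tens_eqI[OF x lB]) (auto intro: linI)
  then show ?thesis by (simp add: B_def T1_def T2_def)
qed

subsection \<open>Reduced words\<close>

definition inversions :: "nat \<Rightarrow> (nat \<Rightarrow> nat) \<Rightarrow> (nat \<times> nat) set" where
  "inversions N w = {(a, b). a < b \<and> b < N \<and> w b < w a}"

definition ninv :: "nat \<Rightarrow> (nat \<Rightarrow> nat) \<Rightarrow> nat" where
  "ninv N w = card (inversions N w)"

abbreviation adj :: "nat \<Rightarrow> nat \<Rightarrow> nat" where
  "adj i \<equiv> transpose i (Suc i)"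

lemma adj_adj [simp]: "adj i \<circ> adj i = id" "w \<circ> adj i \<circ> adj i = w"
  by (auto simp: fun_eq_iff)

lemma adj_permutes: "Suc i < N \<Longrightarrow> adj i permutes {..<N}"
  by (rule permutes_swap_id) auto

lemma adj_less: "a < b \<Longrightarrow> (a, b) \<noteq> (i, Suc i) \<Longrightarrow> adj i a < adj i b"
  by (auto simp: transpose_def)

lemma finite_inversions: "finite (inversions N w)"
  by (rule finite_subset[of _ "{..<N} \<times> {..<N}"]) (auto simp: inversions_def)

lemma adj_lessThan: "Suc i < N \<Longrightarrow> adj i a < N \<longleftrightarrow> a < N"
  by (auto simp: transpose_def)

text \<open>The transposition reverses the order of no pair of positions except (i, i+1). It
  therefore carries the old inversions bijectively to the new ones other than (i, i+1).\<close>

lemma ninv_comp_adj: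
  assumes "Suc i < N" "w i < w (Suc i)"
  shows "ninv N (w \<circ> adj i) = Suc (ninv N w)"
proof -
  let ?f = "map_prod (adj i) (adj i)"
  have "inversions N (w \<circ> adj i) = insert (i, Suc i) (?f ` inversions N w)"
  proof (intro equalityI subsetI)
    fix x assume x: "x \<in> inversions N (w \<circ> adj i)"
    obtain a b where ab: "x = (a, b)" by force
    show "x \<in> insert (i, Suc i) (?f ` inversions N w)"
    proof (cases "x = (i, Suc i)")
      case False
      then have "(adj i a, adj i b) \<in> inversions N w"
        using x ab adj_less[of a b i] adj_lessThan[OF assms(1)] by (auto simp: inversions_def)
      then have "?f (adj i a, adj i b) \<in> ?f ` inversions N w" by blast
      then show ?thesis by (simp add: ab)
    qed simp
  next
    fix x assume "x \<in> insert (i, Suc i) (?f ` inversions N w)"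
    then show "x \<in> inversions N (w \<circ> adj i)"
    proof
      assume "x \<in> ?f ` inversions N w"
      then obtain a b where ab: "x = (adj i a, adj i b)" "(a, b) \<in> inversions N w" by auto
      then have "(a, b) \<noteq> (i, Suc i)" using assms(2) by (auto simp: inversions_def)
      then show ?thesis
        using ab adj_less[of a b i] adj_lessThan[OF assms(1)] by (auto simp: inversions_def)
    qed (use assms in \<open>simp add: inversions_def\<close>)
  qed
  moreover have "(i, Suc i) \<notin> ?f ` inversions N w"
  proof
    assume "(i, Suc i) \<in> ?f ` inversions N w"
    then obtain a b where ab: "i = adj i a" "Suc i = adj i b" "a < b"
      by (auto simp: inversions_def)
    have "a = Suc i" using arg_cong[OF ab(1), of "adj i"] by simp
    moreover have "b = i" using arg_cong[OF ab(2), of "adj i"] by simp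
    ultimately show False using ab(3) by simp
  qed
  moreover have "inj ?f"
    by (intro prod.inj_map) auto
  ultimately show ?thesis
    by (simp add: ninv_def finite_inversions card_image inj_on_subset)
qed

lemma ninv_comp_adj_descent:
  assumes "Suc i < N" "w (Suc i) < w i"
  shows "ninv N w = Suc (ninv N (w \<circ> adj i))"
  using ninv_comp_adj[of i N "w \<circ> adj i"] assms by simp

lemma ninv_inv:
  assumes "w permutes {..<N}"
  shows "ninv N (inv w) = ninv N w"
proof -
  have lt: "w a < N \<longleftrightarrow> a < N" "inv w a < N \<longleftrightarrow> a < N" for a
    using permutes_in_image[OF assms, of a] permutes_in_image[OF permutes_inv[OF assms], of a] by auto
  have iw: "w (inv w a) = a" "inv w (w a) = a" for a
    using permutes_inverses[OF assms] by auto
  show ?thesis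
    unfolding ninv_def
  proof (rule bij_betw_same_card[of "\<lambda>(a, b). (inv w b, inv w a)"])
    show "bij_betw (\<lambda>(a, b). (inv w b, inv w a)) (inversions N (inv w)) (inversions N w)"
      by (rule bij_betw_byWitness[where f' = "\<lambda>(a, b). (w b, w a)"])
         (auto simp: inversions_def iw lt less_trans)
  qed
qed

lemma ninv_id [simp]: "ninv N id = 0"
proof -
  have "inversions N id = {}" by (auto simp: inversions_def)
  then show ?thesis by (simp add: ninv_def)
qed

lemma word_perm_simps [simp]:
  "word_perm [] = id" "word_perm (i # us) = adj i \<circ> word_perm us"
  by (simp_all add: word_perm_def)

lemma word_perm_append [simp]: "word_perm (us @ vs) = word_perm us \<circ> word_perm vs"
  by (induction us) (auto simp: o_assoc)

lemma words_simps [simp]: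
  "[] \<in> words N" "i # us \<in> words N \<longleftrightarrow> Suc i < N \<and> us \<in> words N"
  "us @ vs \<in> words N \<longleftrightarrow> us \<in> words N \<and> vs \<in> words N"
  by (auto simp: words_def)

lemma word_perm_permutes: "us \<in> words N \<Longrightarrow> word_perm us permutes {..<N}"
  by (induction us) (auto intro: permutes_compose adj_permutes simp: permutes_id)

lemma permutes_neq: "w permutes {..<N} \<Longrightarrow> w i < w (Suc i) \<or> w (Suc i) < (w i :: nat)"
  using permutes_inj[of w "{..<N}"] by (metis injD linorder_neqE_nat n_not_Suc_n)

text \<open>Each letter changes the inversion number by exactly one, up or down.\<close>

lemma ninv_word_perm_le: "us \<in> words N \<Longrightarrow> ninv N (word_perm us) \<le> length us"
proof (induction us rule: rev_induct)
  case Nil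
  then show ?case by (simp only: word_perm_simps ninv_id list.size)
next
  case (snoc i us)
  have "word_perm us permutes {..<N}" using snoc.prems by (simp add: word_perm_permutes)
  moreover have "word_perm (us @ [i]) = word_perm us \<circ> adj i"
    by (simp only: word_perm_append word_perm_simps comp_id)
  ultimately show ?case
    using permutes_neq[of "word_perm us" N i] snoc ninv_comp_adj[of i N "word_perm us"] ninv_comp_adj_descent[of i N "word_perm us"]
    by (auto simp: comp_def simp del: word_perm_append word_perm_simps)
qed

lemma permutes_no_descent:
  assumes w: "w permutes {..<N}" and asc: "\<And>i. Suc i < N \<Longrightarrow> w i < w (Suc i)"
  shows "w = id"
proof -
  have le: "i \<le> w i" if "i < N" for i
    using that
  proof (induction i)
    case (Suc i)
    then show ?case using asc[of i] by simp
  qed simp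
  have ge: "w i + d < N" if "i + d < N" for i d
    using that
  proof (induction d arbitrary: i)
    case 0
    then show ?case using permutes_in_image[OF w, of i] by simp
  next
    case (Suc d)
    then have "w (Suc i) + d < N" by (intro Suc.IH) simp
    then show ?case using asc[of i] Suc.prems by simp
  qed
  show "w = id"
  proof
    fix i show "w i = id i"
    proof (cases "i < N")
      case True
      then show ?thesis using le[OF True] ge[of i "N - 1 - i"] by simp
    next
      case False
      then show ?thesis using permutes_not_in[OF w, of i] by simp
    qed
  qed
qed

text \<open>Bubble sort: removing a descent costs one letter and one inversion, and only the
  identity has no descent.\<close>

lemma exists_reduced:
  "w permutes {..<N} \<Longrightarrow> \<exists>us\<in>words N. length us = ninv N w \<and> word_perm us = w"
proof (induction "ninv N w" arbitrary: w rule: less_induct)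
  case less
  show ?case
  proof (cases "\<exists>i. Suc i < N \<and> w (Suc i) < w i")
    case True
    then obtain i where i: "Suc i < N" "w (Suc i) < w i" by blast
    have "w \<circ> adj i permutes {..<N}"
      using less.prems i(1) by (intro permutes_compose adj_permutes)
    moreover have n: "ninv N w = Suc (ninv N (w \<circ> adj i))"
      by (rule ninv_comp_adj_descent[OF i])
    ultimately obtain us where "us \<in> words N" "length us = ninv N (w \<circ> adj i)" "word_perm us = w \<circ> adj i"
      using less.hyps[of "w \<circ> adj i"] by auto
    then show ?thesis
      using i n by (intro bexI[of _ "us @ [i]"]) auto
  next
    case False
    then have "w = id"
      using permutes_no_descent[OF less.prems] permutes_neq[OF less.prems] by blast
    then show ?thesis by (intro bexI[of _ "[]"]) auto
  qed
qed

lemma perm_length_eq: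
  assumes "w permutes {..<N}"
  shows "perm_length N w = ninv N w"
  unfolding perm_length_def
proof (rule Least_equality)
  show "\<exists>us\<in>words N. length us = ninv N w \<and> word_perm us = w"
    by (rule exists_reduced[OF assms])
qed (auto dest: ninv_word_perm_le)

lemma reduced_word_iff:
  "w permutes {..<N} \<Longrightarrow>
    reduced_word N w us \<longleftrightarrow> us \<in> words N \<and> word_perm us = w \<and> length us = ninv N w"
  by (simp add: reduced_word_def perm_length_eq)

lemma reduced_snocD:
  assumes "reduced_word N w (us @ [i])" "w permutes {..<N}"
  shows "Suc i < N" "w (Suc i) < w i" "reduced_word N (w \<circ> adj i) us"
proof -
  have r: "us \<in> words N" "Suc i < N" "word_perm us \<circ> adj i = w" "Suc (length us) = ninv N w"
    using assms by (auto simp: reduced_word_iff)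
  have u: "word_perm us = w \<circ> adj i" using r(3) by auto
  show "Suc i < N" by fact
  have le: "ninv N (w \<circ> adj i) \<le> length us"
    using ninv_word_perm_le[OF r(1)] u by simp
  show d: "w (Suc i) < w i"
    using permutes_neq[OF assms(2), of i] ninv_comp_adj[of i N w] r(2,4) le by auto
  have "w \<circ> adj i permutes {..<N}"
    using assms r(2) by (intro permutes_compose adj_permutes)
  then show "reduced_word N (w \<circ> adj i) us"
    using ninv_comp_adj_descent[OF r(2) d] r u by (simp add: reduced_word_iff)
qed

lemma reduced_snocI:
  assumes "reduced_word N (w \<circ> adj i) us" "w permutes {..<N}" "Suc i < N" "w (Suc i) < w i"
  shows "reduced_word N w (us @ [i])"
proof -
  have "w \<circ> adj i permutes {..<N}"
    using assms by (intro permutes_compose adj_permutes)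
  then show ?thesis
    using assms ninv_comp_adj_descent[OF assms(3,4)] by (auto simp: reduced_word_iff)
qed

text \<open>Induction on the inversion number. The last letters i and j of two reduced words are
  both descents of w, so w also has reduced words ending in the two sides of the commutation or
  braid relation for i, j. The induction hypothesis links each given word to one of these. Letters
  are split off on the right because \<open>foldr\<close> applies the last letter first. The
  relations are required only on the invariant set \<open>X\<close>, as the Hecke relations hold
  only on \<open>tens N\<close>.\<close>

lemma matsumoto:
  fixes T :: "nat \<Rightarrow> 'a \<Rightarrow> 'a"
  assumes closed: "\<And>i x. Suc i < N \<Longrightarrow> x \<in> X \<Longrightarrow> T i x \<in> X"
    and comm: "\<And>i j x. Suc i < j \<Longrightarrow> Suc j < N \<Longrightarrow> x \<in> X \<Longrightarrow> T i (T j x) = T j (T i x)"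
    and braid: "\<And>i x. Suc (Suc i) < N \<Longrightarrow> x \<in> X \<Longrightarrow> T i (T (Suc i) (T i x)) = T (Suc i) (T i (T (Suc i) x))"
  shows "w permutes {..<N} \<Longrightarrow> reduced_word N w us \<Longrightarrow> reduced_word N w vs \<Longrightarrow> x \<in> X \<Longrightarrow>
    foldr T us x = foldr T vs x"
proof (induction "ninv N w" arbitrary: w us vs x rule: less_induct)
  case less
  note w = less.prems(1)
  have perm: "u \<circ> adj i permutes {..<N}" if "u permutes {..<N}" "Suc i < N" for u i
    using that by (intro permutes_compose adj_permutes)
  have len: "length us = ninv N w" "length vs = ninv N w"
    using less.prems by (simp_all add: reduced_word_iff)
  have ex: "\<exists>c. reduced_word N u c" if "u permutes {..<N}" for u
    using exists_reduced[OF that] that by (auto simp: reduced_word_iff)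
  show ?case
  proof (cases "ninv N w = 0")
    case True
    then show ?thesis using len by simp
  next
    case False
    then obtain a i b j where us: "us = a @ [i]" and vs: "vs = b @ [j]"
      using len by (metis append_butlast_last_id length_0_conv)
    have i: "Suc i < N" "w (Suc i) < w i" "reduced_word N (w \<circ> adj i) a"
      using reduced_snocD[of N w a i] less.prems us by auto
    have j: "Suc j < N" "w (Suc j) < w j" "reduced_word N (w \<circ> adj j) b"
      using reduced_snocD[of N w b j] less.prems vs by auto
    have IH: "foldr T c y = foldr T d y"
      if "k = i \<or> k = j" "reduced_word N (w \<circ> adj k) c" "reduced_word N (w \<circ> adj k) d" "y \<in> X" for k c d y
    proof (rule less.hyps[of "w \<circ> adj k"])
      have "Suc k < N" "w (Suc k) < w k" using that(1) i(1,2) j(1,2) by auto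
      then show "ninv N (w \<circ> adj k) < ninv N w" "w \<circ> adj k permutes {..<N}"
        using ninv_comp_adj_descent[of k N w] perm[OF w] by auto
    qed (use that in auto)
    \<comment> \<open>Formulated for the smaller letter i' so that both orders of i and j are
      instances.\<close>
    have main: "foldr T a' (T i' x) = foldr T b' (T j' x)"
      if lt: "i' < j'" and ij: "i' = i \<and> j' = j \<or> i' = j \<and> j' = i"
        and a': "reduced_word N (w \<circ> adj i') a'" and b': "reduced_word N (w \<circ> adj j') b'"
      for i' j' a' b'
    proof -
      have ij': "Suc i' < N" "w (Suc i') < w i'" "Suc j' < N" "w (Suc j') < w j'"
        using ij i j by auto
      note IHi = IH[of i' a'] and IHj = IH[of j' b']
      show ?thesis
      proof (cases "j' = Suc i'")
        case False
        then have far: "Suc i' < j'" using lt by simp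
        let ?u = "w \<circ> adj i' \<circ> adj j'"
        have com: "adj i' \<circ> adj j' = adj j' \<circ> adj i'"
          using far by (auto simp: fun_eq_iff transpose_def)
        then have u2: "?u = w \<circ> adj j' \<circ> adj i'" by (metis o_assoc)
        obtain c where c: "reduced_word N ?u c"
          using ex perm[OF perm[OF w]] ij' by blast
        have 1: "reduced_word N (w \<circ> adj i') (c @ [j'])"
          by (rule reduced_snocI) (use c ij' far perm[OF w] in \<open>auto simp: transpose_def\<close>)
        have 2: "reduced_word N (w \<circ> adj j') (c @ [i'])"
          by (rule reduced_snocI) (use c[unfolded u2] ij' far perm[OF w] in \<open>auto simp: transpose_def\<close>)
        have "foldr T a' (T i' x) = foldr T c (T j' (T i' x))"
          using IHi[of "c @ [j']" "T i' x"] ij a' 1 closed ij' less.prems(4) by auto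
        also have "\<dots> = foldr T c (T i' (T j' x))"
          using comm[OF far] ij' less.prems(4) by simp
        also have "\<dots> = foldr T b' (T j' x)"
          using IHj[of "c @ [i']" "T j' x"] ij b' 2 closed ij' less.prems(4) by auto
        finally show ?thesis .
      next
        case True
        \<comment> \<open>Two adjacent descents mean that w reverses the order of three consecutive
          positions, so three letters can be split off, in either form of the braid
          relation.\<close>
        let ?u = "w \<circ> adj i' \<circ> adj j' \<circ> adj i'"
        have "adj i' \<circ> adj j' \<circ> adj i' = adj j' \<circ> adj i' \<circ> adj j'"
          using True by (auto simp: fun_eq_iff transpose_def)
        then have u2: "?u = w \<circ> adj j' \<circ> adj i' \<circ> adj j'" by (metis o_assoc)
        obtain c where c: "reduced_word N ?u c"
          using ex perm[OF perm[OF perm[OF w]]] ij' by blast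
        have c1: "reduced_word N (w \<circ> adj i' \<circ> adj j') (c @ [i'])"
          by (rule reduced_snocI) (use c ij' True perm[OF perm[OF w]] in \<open>auto simp: transpose_def\<close>)
        have 1: "reduced_word N (w \<circ> adj i') ((c @ [i']) @ [j'])"
          by (rule reduced_snocI) (use c1 ij' True perm[OF w] in \<open>auto simp: transpose_def\<close>)
        have c2: "reduced_word N (w \<circ> adj j' \<circ> adj i') (c @ [j'])"
          by (rule reduced_snocI) (use c[unfolded u2] ij' True perm[OF perm[OF w]] in \<open>auto simp: transpose_def\<close>)
        have 2: "reduced_word N (w \<circ> adj j') ((c @ [j']) @ [i'])"
          by (rule reduced_snocI) (use c2 ij' True perm[OF w] in \<open>auto simp: transpose_def\<close>)
        have "foldr T a' (T i' x) = foldr T c (T i' (T j' (T i' x)))"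
          using IHi[of "(c @ [i']) @ [j']" "T i' x"] ij a' 1 closed ij' less.prems(4) by auto
        also have "\<dots> = foldr T c (T j' (T i' (T j' x)))"
          using braid[of i' x] True ij' less.prems(4) by simp
        also have "\<dots> = foldr T b' (T j' x)"
          using IHj[of "(c @ [j']) @ [i']" "T j' x"] ij b' 2 closed ij' less.prems(4) by auto
        finally show ?thesis .
      qed
    qed
    show ?thesis
    proof (cases i j rule: linorder_cases)
      case less
      then show ?thesis using main[of i j a b] i(3) j(3) by (simp add: us vs)
    next
      case equal
      then show ?thesis using IH[of i a b "T i x"] i(1,3) j(3) closed less.prems(4) by (simp add: us vs)
    next
      case greater
      then show ?thesis using main[of j i b a] i(3) j(3) by (simp add: us vs)
    qed
  qed
qed

section \<open>Sums over the symmetric group and coset representatives\<close>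

abbreviation Perms :: "nat \<Rightarrow> (nat \<Rightarrow> nat) set" where
  "Perms N \<equiv> {w. w permutes {..<N}}"

lemma finite_Perms [simp]: "finite (Perms N)"
  by (simp add: finite_permutations)

lemma sum_involution:
  fixes f :: "'a \<Rightarrow> 'b :: comm_monoid_add"
  assumes "finite P" "\<And>x. x \<in> P \<Longrightarrow> \<sigma> x \<in> P \<and> \<sigma> (\<sigma> x) = x \<and> (D (\<sigma> x) \<longleftrightarrow> \<not> D x)"
  shows "sum f P = (\<Sum>x | x \<in> P \<and> D x. f x + f (\<sigma> x))"
proof -
  have "(\<Sum>x | x \<in> P \<and> \<not> D x. f x) = (\<Sum>x | x \<in> P \<and> D x. f (\<sigma> x))"
    by (rule sum.reindex_bij_witness[of _ \<sigma> \<sigma>]) (use assms(2) in auto)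
  moreover have "sum f P = (\<Sum>x | x \<in> P \<and> D x. f x) + (\<Sum>x | x \<in> P \<and> \<not> D x. f x)"
    using assms(1) by (subst sum.union_disjoint[symmetric]) (auto intro!: sum.cong)
  ultimately show ?thesis by (simp add: sum.distrib)
qed

lemma adj_inv_eq: "w permutes {..<N} \<Longrightarrow> inv (adj i \<circ> w) = inv w \<circ> adj i"
  using o_inv_distrib[of "adj i" w] permutes_bij[of w] bij_transpose[of i "Suc i"] by (simp add: inv_transpose_eq)

lemma ninv_adj_comp:
  assumes "Suc i < N" "w permutes {..<N}" "inv w i < inv w (Suc i)"
  shows "ninv N (adj i \<circ> w) = Suc (ninv N w)"
  using ninv_comp_adj[OF assms(1,3)] assms(1,2)
  by (metis adj_inv_eq adj_permutes ninv_inv permutes_compose)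

lemma ninv_Suc:
  assumes "w permutes {..<N}"
  shows "ninv (Suc N) w = ninv N w"
proof -
  have "w N = N" using permutes_not_in[OF assms, of N] by simp
  moreover have "w a < N" if "a < N" for a using permutes_in_image[OF assms, of a] that by simp
  ultimately have "inversions (Suc N) w = inversions N w"
    by (auto simp: inversions_def less_Suc_eq) (meson less_asym)
  then show ?thesis by (simp add: ninv_def)
qed

text \<open>The minimal representatives of the left cosets of S_N in S_{N+1}: s_j s_{j+1} ...
  s_{N-1} sends N to j and keeps the order of all other points.\<close>

definition cyc :: "nat \<Rightarrow> nat \<Rightarrow> nat \<Rightarrow> nat" where
  "cyc N j = word_perm [j..<N]"

lemma cyc_self: "cyc N N = id"
  by (simp add: cyc_def)

lemma cyc_step: "j < N \<Longrightarrow> cyc N j = adj j \<circ> cyc N (Suc j)"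
  by (simp add: cyc_def upt_conv_Cons)

lemma upt_words: "[j..<N] \<in> words (Suc N)"
  by (auto simp: words_def)

lemma cyc_permutes: "cyc N j permutes {..<Suc N}"
  unfolding cyc_def by (rule word_perm_permutes[OF upt_words])

lemma cyc_fix: "j \<le> N \<Longrightarrow> k < j \<Longrightarrow> cyc N j k = k"
  by (induction j rule: inc_induct) (auto simp: cyc_self cyc_step)

lemma cyc_last: "j \<le> N \<Longrightarrow> cyc N j N = j"
  by (induction j rule: inc_induct) (auto simp: cyc_self cyc_step)

lemma permutes_Suc: "w permutes {..<N} \<Longrightarrow> w permutes {..<Suc N}"
  by (rule permutes_subset) auto

text \<open>Each new factor on the left exchanges the values j and j + 1. At that stage j + 1 is the
  value at the last position N, so j comes before it and exactly one inversion is added.\<close>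

lemma ninv_cyc:
  assumes w: "w permutes {..<N}" and j: "j \<le> N"
  shows "ninv (Suc N) (cyc N j \<circ> w) = N - j + ninv N w"
  using j
proof (induction j rule: inc_induct)
  case base
  then show ?case by (simp add: cyc_self ninv_Suc[OF w])
next
  case (step j)
  let ?u = "cyc N (Suc j) \<circ> w"
  have p: "?u permutes {..<Suc N}"
    by (intro permutes_compose permutes_Suc[OF w] cyc_permutes)
  have "w N = N" using permutes_not_in[OF w, of N] by simp
  then have "?u N = Suc j" using step cyc_last[of "Suc j" N] by simp
  then have iN: "inv ?u (Suc j) = N" using permutes_inv_eq[OF p] by metis
  have lt: "inv w j < N" using permutes_in_image[OF permutes_inv[OF w], of j] step by simp
  have "?u (inv w j) = j"
    using cyc_fix[of "Suc j" N j] permutes_inverses[OF w] step by simp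
  then have "inv ?u j = inv w j" using permutes_inv_eq[OF p] by metis
  then have "ninv (Suc N) (adj j \<circ> ?u) = Suc (ninv (Suc N) ?u)"
    using iN lt step by (intro ninv_adj_comp p) auto
  then show ?case using step by (simp add: cyc_step comp_def Suc_diff_le)
qed

lemma reduced_cyc:
  assumes w: "w permutes {..<N}" and j: "j \<le> N" and us: "reduced_word N w us"
  shows "reduced_word (Suc N) (cyc N j \<circ> w) ([j..<N] @ us)"
proof -
  have p: "cyc N j \<circ> w permutes {..<Suc N}"
    by (intro permutes_compose permutes_Suc[OF w] cyc_permutes)
  have "us \<in> words (Suc N)" "word_perm us = w" "length us = ninv N w"
    using us by (auto simp: reduced_word_iff[OF w] words_def)
  then show ?thesis
    unfolding reduced_word_iff[OF p] using upt_words[of j N] ninv_cyc[OF w j] by (simp add: cyc_def)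
qed

text \<open>The index j of the coset is recovered as the image of N under the permutation.\<close>

lemma sum_Perms_Suc:
  "(\<Sum>w\<in>Perms (Suc N). f w) = (\<Sum>j\<le>N. \<Sum>w\<in>Perms N. f (cyc N j \<circ> w))"
proof -
  have bij: "bij (cyc N j)" for j using permutes_bij[OF cyc_permutes] .
  have lastw: "w N \<le> N" if "w permutes {..<Suc N}" for w
    using permutes_in_image[OF that, of N] by simp
  have "(\<Sum>w\<in>Perms (Suc N). f w) = (\<Sum>(j, w)\<in>{..N} \<times> Perms N. f (cyc N j \<circ> w))"
  proof (rule sum.reindex_bij_witness[of _ "\<lambda>(j, w). cyc N j \<circ> w" "\<lambda>w. (w N, inv (cyc N (w N)) \<circ> w)"])
    fix w assume w: "w \<in> Perms (Suc N)"
    let ?w = "inv (cyc N (w N)) \<circ> w"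
    show eq: "(case (w N, ?w) of (j, w) \<Rightarrow> cyc N j \<circ> w) = w"
      using permutes_inverses[OF cyc_permutes] by (auto simp: fun_eq_iff)
    show "(case (w N, ?w) of (j, w) \<Rightarrow> f (cyc N j \<circ> w)) = f w"
      using eq by simp
    have p: "?w permutes {..<Suc N}"
      using w by (intro permutes_compose permutes_inv cyc_permutes) simp
    have "?w N = N"
      using permutes_inv_eq[OF cyc_permutes, of N "w N"] cyc_last[of "w N" N] lastw w by auto
    then have "?w permutes {..<N}"
      using p by (auto intro!: permutes_superset[OF p] simp: less_Suc_eq)
    then show "(w N, ?w) \<in> {..N} \<times> Perms N"
      using lastw w by auto
  next
    fix jw assume "jw \<in> {..N} \<times> Perms N"
    then obtain j w where jw: "jw = (j, w)" "j \<le> N" "w permutes {..<N}" by auto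
    have "w N = N" using permutes_not_in[OF jw(3), of N] by simp
    then have "(cyc N j \<circ> w) N = j" using cyc_last[OF jw(2)] by simp
    moreover have "inv (cyc N j) \<circ> (cyc N j \<circ> w) = w"
      using permutes_inverses[OF cyc_permutes] by (auto simp: fun_eq_iff)
    ultimately show "((case jw of (j, w) \<Rightarrow> cyc N j \<circ> w) N,
        inv (cyc N ((case jw of (j, w) \<Rightarrow> cyc N j \<circ> w) N)) \<circ> (case jw of (j, w) \<Rightarrow> cyc N j \<circ> w)) = jw"
      using jw by simp
    show "(case jw of (j, w) \<Rightarrow> cyc N j \<circ> w) \<in> Perms (Suc N)"
      using jw by (auto intro: permutes_compose permutes_Suc cyc_permutes)
  qed
  then show ?thesis by (simp add: sum.cartesian_product)
qed

subsection \<open>The antisymmetrizer\<close>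

definition hecke_w :: "nat \<Rightarrow> complex \<Rightarrow> nat \<Rightarrow> (nat \<Rightarrow> nat) \<Rightarrow> tensor \<Rightarrow> tensor" where
  "hecke_w n v N w = foldr (hecke_op n v) (SOME us. reduced_word N w us)"

lemma lin_foldr: "(\<And>i. lin (f i)) \<Longrightarrow> lin (foldr f us)"
proof (induction us)
  case Nil
  then show ?case by (simp add: lin_def)
next
  case (Cons i us)
  then show ?case by (simp add: lin_def)
qed

lemma tens_foldr: "x \<in> tens N \<Longrightarrow> foldr (hecke_op n v) us x \<in> tens N"
  by (induction us) auto

lemma lin_hecke_w: "lin (hecke_w n v N w)"
  by (simp add: hecke_w_def lin_foldr)

lemma exists_reduced_word: "w permutes {..<N} \<Longrightarrow> \<exists>us. reduced_word N w us"
  using exists_reduced[of w N] by (auto simp: reduced_word_iff)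

lemma hecke_w_reduced:
  assumes "n \<ge> 1" "v \<noteq> 0" "w permutes {..<N}" "reduced_word N w us" "x \<in> tens N"
  shows "hecke_w n v N w x = foldr (hecke_op n v) us x"
  unfolding hecke_w_def
proof (rule matsumoto[where X = "tens N"])
  show "reduced_word N w (SOME us. reduced_word N w us)"
    using assms(4) by (rule someI)
qed (use assms in \<open>auto intro: hecke_op_commute hecke_op_braid\<close>)

lemma hecke_perm_eq:
  assumes "n \<ge> 1" "w permutes {..<N}" "x \<in> tens N"
  shows "hecke_perm n v N w x = hecke_w n v N w x"
proof -
  let ?us = "SOME us. reduced_word N w us"
  have "reduced_word N w ?us"
    using exists_reduced_word[OF assms(2)] by (rule someI_ex)
  then have "?us \<in> words N" by (simp add: reduced_word_def)
  then have "foldr (hecke n v N) us x = foldr (hecke_op n v) us x" if "us \<in> words N" for us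
    using that
  proof (induction us)
    case (Cons i us)
    then show ?case using hecke_eq[OF assms(1) tens_foldr[OF assms(3)]] by simp
  qed simp
  then show ?thesis using \<open>?us \<in> words N\<close> by (simp add: hecke_perm_def hecke_w_def)
qed

text \<open>The antisymmetrizer before normalization; (-v)^(-l) is written as (-1/v)^l to keep
  natural exponents.\<close>

definition asum :: "nat \<Rightarrow> complex \<Rightarrow> nat \<Rightarrow> tensor \<Rightarrow> tensor" where
  "asum n v N x = (\<Sum>w\<in>Perms N. scl ((- inverse v) ^ ninv N w) (hecke_w n v N w x))"

lemma lin_asum [simp]: "lin (asum n v N)"
  unfolding asum_def by (intro lin_const_sum lin_scale lin_hecke_w)

lemma tens_hecke_w: "x \<in> tens N \<Longrightarrow> hecke_w n v N w x \<in> tens N"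
  by (simp add: hecke_w_def tens_foldr)

lemma tens_asum [simp]: "x \<in> tens N \<Longrightarrow> asum n v N x \<in> tens N"
  unfolding asum_def tens_supp
  by (intro supp_sum supp_scl) (use tens_hecke_w in \<open>auto simp: tens_supp\<close>)

lemma antisym_eq:
  assumes "n \<ge> 1" "x \<in> tens N"
  shows "antisym n v N x = scl (1 / qfact_minus v N) (asum n v N x)"
proof -
  have "(- v) powi (- int l) = (- inverse v) ^ l" for l
    by (simp only: power_int_minus power_int_of_nat inverse_minus_eq[symmetric] power_inverse)
  then show ?thesis
    unfolding antisym_def asum_def using assms
    by (auto intro!: arg_cong[of _ _ "scl _"] sum.cong simp: hecke_perm_eq perm_length_eq)
qed

lemma hecke_w_comp_adj:
  assumes "n \<ge> 1" "v \<noteq> 0" "w permutes {..<N}" "Suc i < N" "w i < w (Suc i)" "x \<in> tens N"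
  shows "hecke_w n v N (w \<circ> adj i) x = hecke_w n v N w (hecke_op n v i x)"
proof -
  obtain us where us: "reduced_word N w us"
    using exists_reduced_word[OF assms(3)] by blast
  have p: "w \<circ> adj i permutes {..<N}"
    using assms by (intro permutes_compose adj_permutes)
  have "reduced_word N (w \<circ> adj i) (us @ [i])"
    using us assms by (intro reduced_snocI p) auto
  then show ?thesis
    using assms us p by (simp add: hecke_w_reduced)
qed

lemma hecke_w_adj_comp:
  assumes "n \<ge> 1" "v \<noteq> 0" "w permutes {..<N}" "Suc i < N" "inv w i < inv w (Suc i)" "x \<in> tens N"
  shows "hecke_w n v N (adj i \<circ> w) x = hecke_op n v i (hecke_w n v N w x)"
proof -
  obtain us where us: "reduced_word N w us"
    using exists_reduced_word[OF assms(3)] by blast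
  have p: "adj i \<circ> w permutes {..<N}"
    using assms by (intro permutes_compose adj_permutes)
  have "reduced_word N (adj i \<circ> w) (i # us)"
    using us assms ninv_adj_comp[of i N w] by (auto simp: reduced_word_iff[OF assms(3)] reduced_word_iff[OF p])
  then show ?thesis
    using assms us p by (simp add: hecke_w_reduced)
qed

text \<open>Pair \<open>w\<close> with \<open>s\<^sub>i w\<close>, respectively \<open>w s\<^sub>i\<close>, and use the quadratic relation on each pair.\<close>

lemma hecke_op_asum:
  assumes "n \<ge> 1" "v \<noteq> 0" "Suc i < N" "x \<in> tens N"
  shows "hecke_op n v i (asum n v N x) = scl (- inverse v) (asum n v N x)"
proof -
  let ?u = "- inverse v" and ?T = "hecke_op n v i"
  have vv: "v * (inverse v * c) = c" for c
    using assms(2) by simp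
  let ?f = "\<lambda>w. scl (?u ^ ninv N w) (hecke_w n v N w x)"
  let ?P = "{w. w \<in> Perms N \<and> inv w i < inv w (Suc i)}"
  have "asum n v N x = (\<Sum>w\<in>?P. ?f w + ?f (adj i \<circ> w))"
    unfolding asum_def
  proof (rule sum_involution)
    fix w assume "w \<in> Perms N"
    then have w: "w permutes {..<N}" by simp
    then show "adj i \<circ> w \<in> Perms N \<and> adj i \<circ> (adj i \<circ> w) = w \<and>
        (inv (adj i \<circ> w) i < inv (adj i \<circ> w) (Suc i) \<longleftrightarrow> \<not> inv w i < inv w (Suc i))"
      using permutes_compose[OF w adj_permutes[OF assms(3)]] permutes_neq[OF permutes_inv[OF w], of i]
      by (auto simp: adj_inv_eq[OF w] fun_eq_iff)
  qed simp
  moreover have "?T (?f w + ?f (adj i \<circ> w)) = scl ?u (?f w + ?f (adj i \<circ> w))" if "w \<in> ?P" for w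
    using that assms tens_hecke_w[OF assms(4)]
    by (simp add: ninv_adj_comp hecke_w_adj_comp lin_add[OF lin_hecke_op] lin_scl[OF lin_hecke_op]
        hecke_op_quadratic[where N = N]) (simp add: scl_distrib algebra_simps vv)
  ultimately show ?thesis
    by (simp add: lin_sum[OF lin_hecke_op] scl_sum)
qed

lemma asum_hecke_op:
  assumes "n \<ge> 1" "v \<noteq> 0" "Suc i < N" "x \<in> tens N"
  shows "asum n v N (hecke_op n v i x) = scl (- inverse v) (asum n v N x)"
proof -
  let ?u = "- inverse v" and ?T = "hecke_op n v i"
  have vv: "v * (inverse v * c) = c" for c
    using assms(2) by simp
  let ?f = "\<lambda>x w. scl (?u ^ ninv N w) (hecke_w n v N w x)"
  let ?P = "{w. w \<in> Perms N \<and> w i < w (Suc i)}"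
  have sum: "asum n v N x = (\<Sum>w\<in>?P. ?f x w + ?f x (w \<circ> adj i))" for x
    unfolding asum_def
  proof (rule sum_involution)
    fix w assume "w \<in> Perms N"
    then have w: "w permutes {..<N}" by simp
    then show "w \<circ> adj i \<in> Perms N \<and> w \<circ> adj i \<circ> adj i = w \<and>
        ((w \<circ> adj i) i < (w \<circ> adj i) (Suc i) \<longleftrightarrow> \<not> w i < w (Suc i))"
      using permutes_compose[OF adj_permutes[OF assms(3)] w] permutes_neq[OF w, of i]
      by auto
  qed simp
  have "?f (?T x) w + ?f (?T x) (w \<circ> adj i) = scl ?u (?f x w + ?f x (w \<circ> adj i))" if "w \<in> ?P" for w
    using that assms
    by (simp add: ninv_comp_adj hecke_w_comp_adj lin_add[OF lin_hecke_w] lin_scl[OF lin_hecke_w]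
        hecke_op_quadratic[where N = N]) (simp add: scl_distrib algebra_simps vv)
  then show ?thesis
    unfolding sum by (simp add: scl_sum)
qed

section \<open>Adding a tensor factor at either end\<close>

definition app :: "int \<Rightarrow> tensor \<Rightarrow> tensor" where
  "app j = lin_ext (\<lambda>t. basis (t @ [j]))"

definition con :: "int \<Rightarrow> tensor \<Rightarrow> tensor" where
  "con k = lin_ext (\<lambda>t. basis (k # t))"

lemma lin_app [simp]: "lin (app j)" and lin_con [simp]: "lin (con k)"
  by (simp_all add: app_def con_def)

lemma app_basis [simp]: "app j (basis t) = basis (t @ [j])"
  and con_basis [simp]: "con k (basis t) = basis (k # t)"
  by (simp_all add: app_def con_def)

lemma tens_app [simp]: "x \<in> tens N \<Longrightarrow> app j x \<in> tens (Suc N)"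
  unfolding tens_supp by (rule supp_image[OF lin_app]) (auto simp: supp_basis)

lemma tens_con [simp]: "x \<in> tens N \<Longrightarrow> con k x \<in> tens (Suc N)"
  unfolding tens_supp by (rule supp_image[OF lin_con]) (auto simp: supp_basis)

lemma app_hecke_op:
  assumes "x \<in> tens N" "Suc i < N"
  shows "app j (hecke_op n v i x) = hecke_op n v i (app j x)"
proof (rule tens_eqI[OF assms(1)])
  fix t :: "int list" assume "length t = N"
  then show "app j (hecke_op n v i (basis t)) = hecke_op n v i (app j (basis t))"
    using assms(2)
    by (simp add: hecke_op_basis hecke_basis_sum lin_sum[OF lin_app] lin_scl[OF lin_app] nth_append list_update_append)
qed (auto intro!: lin_intros lin_comp[OF lin_app])

lemma con_hecke_op:
  assumes "x \<in> tens N"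
  shows "con k (hecke_op n v i x) = hecke_op n v (Suc i) (con k x)"
proof (rule tens_eqI[OF assms(1)])
  fix t :: "int list"
  show "con k (hecke_op n v i (basis t)) = hecke_op n v (Suc i) (con k (basis t))"
    by (simp add: hecke_op_basis hecke_basis_sum lin_sum[OF lin_con] lin_scl[OF lin_con])
qed (auto intro!: lin_intros lin_comp[OF lin_con])

lemma app_foldr:
  "x \<in> tens N \<Longrightarrow> us \<in> words N \<Longrightarrow>
    app j (foldr (hecke_op n v) us x) = foldr (hecke_op n v) us (app j x)"
  by (induction us) (auto simp: app_hecke_op[OF tens_foldr])

lemma con_foldr:
  "x \<in> tens N \<Longrightarrow> con k (foldr (hecke_op n v) us x) = foldr (hecke_op n v) (map Suc us) (con k x)"
  by (induction us) (auto simp: con_hecke_op[OF tens_foldr])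

definition antisymmetric :: "nat \<Rightarrow> complex \<Rightarrow> nat \<Rightarrow> tensor \<Rightarrow> bool" where
  "antisymmetric n v N x \<longleftrightarrow>
     x \<in> tens N \<and> (\<forall>i. Suc i < N \<longrightarrow> hecke_op n v i x = scl (- inverse v) x)"

lemma antisymmetric_lin:
  assumes "antisymmetric n v N x" "antisymmetric n v N y"
  shows "antisymmetric n v N (x + y)" "antisymmetric n v N (x - y)" "antisymmetric n v N (scl c x)"
  using assms
  by (simp_all add: antisymmetric_def lin_add[OF lin_hecke_op] lin_diff[OF lin_hecke_op]
      lin_scl[OF lin_hecke_op] scl_distrib mult.commute)

lemma antisymmetric_foldr:
  assumes "antisymmetric n v N x" "us \<in> words N"
  shows "foldr (hecke_op n v) us x = scl ((- inverse v) ^ length us) x"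
  using assms(2)
proof (induction us)
  case (Cons i us)
  then show ?case
    using assms(1) by (simp add: antisymmetric_def lin_scl[OF lin_hecke_op] mult.commute)
qed simp

section \<open>Quantum integers and the projection onto the wedge space\<close>

locale generic_hecke =
  fixes n :: nat and v :: complex
  assumes n: "n \<ge> 1" and v0: "v \<noteq> 0" and generic: "\<And>r :: nat. r \<ge> 1 \<Longrightarrow> v ^ r \<noteq> 1"
begin

abbreviation u :: complex where "u \<equiv> - inverse v"

abbreviation T :: "nat \<Rightarrow> tensor \<Rightarrow> tensor" where "T \<equiv> hecke_op n v"

abbreviation anti :: "nat \<Rightarrow> tensor \<Rightarrow> bool" where "anti \<equiv> antisymmetric n v"

abbreviation qf :: "nat \<Rightarrow> complex" where "qf \<equiv> qfact_minus v"

lemma u_power: "u ^ (2 * i) = inverse (v ^ (2 * i))"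
  by (simp add: power_mult power_inverse)

lemma u_power_neq: "i \<ge> 1 \<Longrightarrow> u ^ (2 * i) \<noteq> 1"
  unfolding u_power using generic[of "2 * i"] by auto

lemma powi_u: "v powi (- 2 * int i) = u ^ (2 * i)"
proof -
  have "v powi (- 2 * int i) = v powi (- int (2 * i))" by simp
  also have "\<dots> = inverse (v ^ (2 * i))" by (simp only: power_int_minus power_int_of_nat)
  finally show ?thesis unfolding u_power .
qed

lemma qnum_minus_u: "qnum_minus v i = (u ^ (2 * i) - 1) / (u ^ 2 - 1)"
proof -
  have "v powi (- 2) = u ^ 2" using powi_u[of 1] by simp
  then show ?thesis unfolding qnum_minus_def powi_u by simp
qed

lemma qnum_minus_neq: "i \<ge> 1 \<Longrightarrow> qnum_minus v i \<noteq> 0"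
  using u_power_neq[of i] u_power_neq[of 1] by (simp add: qnum_minus_u)

lemma qnum_minus_sum: "qnum_minus v (Suc N) = (\<Sum>j\<le>N. u ^ (2 * (N - j)))"
proof -
  have "(\<Sum>j\<le>N. u ^ (2 * (N - j))) = (\<Sum>j\<le>N. (u ^ 2) ^ j)"
    by (rule sum.reindex_bij_witness[of _ "\<lambda>j. N - j" "\<lambda>j. N - j"]) (auto simp: power_mult)
  also have "\<dots> = ((u ^ 2) ^ Suc N - 1) / (u ^ 2 - 1)"
    using u_power_neq[of 1] geometric_sum[of "u ^ 2" "Suc N"] by (simp add: lessThan_Suc_atMost)
  finally show ?thesis unfolding qnum_minus_u power_mult by simp
qed

lemma qnum_plus_minus: "qnum_plus v (Suc i) = v ^ (2 * i) * qnum_minus v (Suc i)"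
proof -
  have p: "v powi (2 * int (Suc i)) = v ^ (2 * Suc i)"
    using power_int_of_nat[of v "2 * Suc i"] by simp
  have p2: "v powi 2 = v ^ 2" using power_int_of_nat[of v 2] by simp
  define a b where "a = v ^ 2" and "b = v ^ (2 * i)"
  have ab: "a \<noteq> 0" "b \<noteq> 0" "a \<noteq> 1" "v ^ (2 * Suc i) = a * b" "u ^ (2 * Suc i) = inverse (a * b)" "u ^ 2 = inverse a"
    using v0 generic[of 2] u_power[of "Suc i"] u_power[of 1] by (simp_all add: a_def b_def power_add power2_eq_square)
  have "inverse a \<noteq> 1" using ab by auto
  then have "(a * b - 1) / (a - 1) = b * ((inverse (a * b) - 1) / (inverse a - 1))"
    using ab by (simp add: field_simps)
  then show ?thesis
    unfolding qnum_plus_def qnum_minus_u p p2 ab a_def[symmetric] b_def[symmetric] .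
qed

lemma qf_Suc: "qf (Suc N) = qnum_minus v (Suc N) * qf N"
  by (simp add: qfact_minus_def mult.commute)

lemma qf_neq: "qf N \<noteq> 0"
  by (auto simp: qfact_minus_def qnum_minus_neq)

text \<open>The Poincare polynomial of S_N at \<open>u\<close>^2, computed coset by coset: the coset
  representatives contribute the geometric sum [N]^-. It is the scalar by which \<open>asum\<close>
  acts on antisymmetric tensors, hence the origin of the normalization by [N]!^-.\<close>

lemma poincare: "(\<Sum>w\<in>Perms N. u ^ (2 * ninv N w)) = qf N"
proof (induction N)
  case 0
  have "Perms 0 = {id}" by (auto simp: permutes_empty)
  then show ?case by (simp only: sum.insert sum.empty) (simp add: qfact_minus_def flip: id_def)
next
  case (Suc N)
  have "(\<Sum>w\<in>Perms (Suc N). u ^ (2 * ninv (Suc N) w)) =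
      (\<Sum>j\<le>N. \<Sum>w\<in>Perms N. u ^ (2 * (N - j)) * u ^ (2 * ninv N w))"
    unfolding sum_Perms_Suc
    by (intro sum.cong refl) (simp only: mem_Collect_eq atMost_iff ninv_cyc add_mult_distrib2 power_add)
  also have "\<dots> = (\<Sum>j\<le>N. u ^ (2 * (N - j))) * (\<Sum>w\<in>Perms N. u ^ (2 * ninv N w))"
    by (simp add: sum_product)
  finally show ?case
    by (simp only: Suc.IH qf_Suc qnum_minus_sum)
qed

text \<open>On such a tensor T_w is the scalar \<open>u\<close>^l(w), which doubles the exponent of
  the coefficient of T_w in \<open>asum\<close>.\<close>

lemma asum_anti: "anti N x \<Longrightarrow> asum n v N x = scl (qf N) x"
proof -
  assume x: "anti N x"
  have "hecke_w n v N w x = scl (u ^ ninv N w) x" if w: "w \<in> Perms N" for w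
  proof -
    obtain us where us: "reduced_word N w us" using exists_reduced_word w by blast
    then have "us \<in> words N" "length us = ninv N w" using w by (auto simp: reduced_word_iff)
    then show ?thesis
      using hecke_w_reduced[OF n v0 _ us, of x] w x antisymmetric_foldr[OF x]
      by (auto simp: antisymmetric_def)
  qed
  then have "asum n v N x = (\<Sum>w\<in>Perms N. scl (u ^ (2 * ninv N w)) x)"
    unfolding asum_def by (intro sum.cong) (auto simp: mult_2 power_add)
  then show ?thesis by (simp only: scl_sum_left[symmetric] poincare)
qed

lemma anti_asum: "x \<in> tens N \<Longrightarrow> anti N (asum n v N x)"
  by (simp add: antisymmetric_def hecke_op_asum[OF n v0])

lemma antisym_anti: "anti N x \<Longrightarrow> antisym n v N x = x"
  using qf_neq[of N] by (simp add: antisym_eq[OF n] asum_anti antisymmetric_def)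

lemma anti_antisym: "x \<in> tens N \<Longrightarrow> anti N (antisym n v N x)"
  using antisymmetric_lin(3)[OF anti_asum anti_asum] by (simp add: antisym_eq[OF n])

lemma Wedge_iff: "x \<in> Wedge n v N \<longleftrightarrow> anti N x"
proof
  assume "x \<in> Wedge n v N"
  then show "anti N x" by (auto simp: Wedge_def anti_antisym)
next
  assume "anti N x"
  moreover then have "x \<in> tens N" by (simp add: antisymmetric_def)
  ultimately show "x \<in> Wedge n v N"
    unfolding Wedge_def by (intro image_eqI[of _ _ x]) (simp_all add: antisym_anti)
qed

section \<open>Well-definedness of the wedge maps\<close>

lemma asum_foldr:
  "us \<in> words N \<Longrightarrow> x \<in> tens N \<Longrightarrow> asum n v N (foldr T us x) = scl (u ^ length us) (asum n v N x)"
  by (induction us) (auto simp: asum_hecke_op[OF n v0 _ tens_foldr])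

text \<open>The larger antisymmetrizer turns every T_w that can be pulled through \<open>L\<close>
  into the scalar \<open>u\<close>^l(w). It is used for appending a factor, which leaves the letters
  of a word unchanged, and for prepending one, which raises each of them by one.\<close>

lemma asum_absorb:
  assumes x: "x \<in> tens N" and "lin L" and tL: "L x \<in> tens (Suc N)"
    and L: "\<And>us. us \<in> words N \<Longrightarrow> \<exists>vs\<in>words (Suc N). length vs = length us \<and> L (foldr T us x) = foldr T vs (L x)"
  shows "asum n v (Suc N) (L (asum n v N x)) = scl (qf N) (asum n v (Suc N) (L x))"
proof -
  have "scl (u ^ ninv N w) (asum n v (Suc N) (L (hecke_w n v N w x))) =
      scl (u ^ (2 * ninv N w)) (asum n v (Suc N) (L x))" if w: "w permutes {..<N}" for w
  proof -
    obtain us where us: "reduced_word N w us" using exists_reduced_word[OF w] by blast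
    then have "us \<in> words N" "length us = ninv N w" using w by (auto simp: reduced_word_iff)
    moreover from L[OF this(1)] obtain vs where "vs \<in> words (Suc N)" "length vs = length us"
      "L (foldr T us x) = foldr T vs (L x)" by blast
    ultimately show ?thesis
      using hecke_w_reduced[OF n v0 w us x] asum_foldr[of vs "Suc N" "L x"] tL
      by (simp add: power_add mult_2)
  qed
  then have "asum n v (Suc N) (L (asum n v N x)) = (\<Sum>w\<in>Perms N. scl (u ^ (2 * ninv N w)) (asum n v (Suc N) (L x)))"
    unfolding asum_def[of n v N]
    by (simp add: lin_sum[OF assms(2)] lin_scl[OF assms(2)] lin_sum[OF lin_asum] lin_scl[OF lin_asum])
  then show ?thesis by (simp only: scl_sum_left[symmetric] poincare)
qed

lemma words_Suc: "us \<in> words N \<Longrightarrow> us \<in> words (Suc N)"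
  by (auto simp: words_def)

lemma antisym_app_absorb:
  assumes "x \<in> tens N"
  shows "antisym n v (Suc N) (app j (antisym n v N x)) = antisym n v (Suc N) (app j x)"
proof -
  have "asum n v (Suc N) (app j (asum n v N x)) = scl (qf N) (asum n v (Suc N) (app j x))"
    using assms app_foldr[OF assms] words_Suc by (intro asum_absorb) auto
  then show ?thesis
    using assms qf_neq[of N] by (simp add: antisym_eq[OF n] lin_scl[OF lin_app] lin_scl[OF lin_asum])
qed

lemma antisym_con_absorb:
  assumes "x \<in> tens N"
  shows "antisym n v (Suc N) (con k (antisym n v N x)) = antisym n v (Suc N) (con k x)"
proof -
  have "\<exists>vs\<in>words (Suc N). length vs = length us \<and> con k (foldr T us x) = foldr T vs (con k x)"
    if "us \<in> words N" for us
    using that by (intro bexI[of _ "map Suc us"]) (auto simp: con_foldr[OF assms] words_def)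
  then have "asum n v (Suc N) (con k (asum n v N x)) = scl (qf N) (asum n v (Suc N) (con k x))"
    using assms by (intro asum_absorb) auto
  then show ?thesis
    using assms qf_neq[of N] by (simp add: antisym_eq[OF n] lin_scl[OF lin_con] lin_scl[OF lin_asum])
qed

lemma antiD: "anti N w \<Longrightarrow> w \<in> tens N"
  by (simp add: antisymmetric_def)

text \<open>By absorption all preimages \<open>x\<close> of w under \<open>antisym\<close> give the
  same value, and w is a preimage of itself.\<close>

lemma wedge_right_eq: "anti N w \<Longrightarrow> wedge_right n v N j w = antisym n v (Suc N) (app j w)"
  unfolding wedge_right_def app_def[symmetric]
  by (rule the_equality) (auto simp: antisym_anti antiD antisym_app_absorb intro!: bexI[of _ w])

lemma wedge_left_eq: "anti N w \<Longrightarrow> wedge_left n v N k w = antisym n v (Suc N) (con k w)"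
  unfolding wedge_left_def con_def[symmetric]
  by (rule the_equality) (auto simp: antisym_anti antiD antisym_con_absorb intro!: bexI[of _ w])

lemma anti_wedge_right: "anti N w \<Longrightarrow> anti (Suc N) (wedge_right n v N j w)"
  by (simp add: wedge_right_eq anti_antisym antiD)

lemma anti_wedge_left: "anti N w \<Longrightarrow> anti (Suc N) (wedge_left n v N k w)"
  by (simp add: wedge_left_eq anti_antisym antiD)

lemma con_app: "con k (app j x) = app j (con k x)"
  by (rule lin_eq_on) (auto intro: lin_comp)

text \<open>After absorption both sides are the antisymmetrization of e_k \<otimes> w \<otimes>
  e_j.\<close>

lemma wedge_left_right:
  assumes "anti N w"
  shows "wedge_left n v (Suc N) k (wedge_right n v N j w) = wedge_right n v (Suc N) j (wedge_left n v N k w)"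
  using assms antisym_con_absorb[of "app j w" "Suc N" k] antisym_app_absorb[of "con k w" "Suc N" j]
  by (simp add: wedge_left_eq wedge_right_eq anti_wedge_left[unfolded wedge_left_eq]
      anti_antisym antiD con_app)

lemma lin_antisym:
  assumes "x \<in> tens N" "y \<in> tens N"
  shows "antisym n v N (x + y) = antisym n v N x + antisym n v N y"
    and "antisym n v N (scl c x) = scl c (antisym n v N x)"
  using assms by (simp_all add: antisym_eq[OF n] lin_add[OF lin_asum] lin_scl[OF lin_asum] scl_distrib mult.commute)

lemma wedge_right_lin:
  assumes "anti N x" "anti N y"
  shows "wedge_right n v N j (x + y) = wedge_right n v N j x + wedge_right n v N j y"
    and "wedge_right n v N j (scl c x) = scl c (wedge_right n v N j x)"
  using assms lin_antisym[of "app j x" "Suc N" "app j y"]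
  by (simp_all add: wedge_right_eq antisymmetric_lin antiD lin_add[OF lin_app] lin_scl[OF lin_app])

lemma wedge_left_lin:
  assumes "anti N x" "anti N y"
  shows "wedge_left n v N k (x + y) = wedge_left n v N k x + wedge_left n v N k y"
    and "wedge_left n v N k (scl c x) = scl c (wedge_left n v N k x)"
  using assms lin_antisym[of "con k x" "Suc N" "con k y"]
  by (simp_all add: wedge_left_eq antisymmetric_lin antiD lin_add[OF lin_con] lin_scl[OF lin_con])

text \<open>Only the minimal coset representatives survive when an antisymmetric factor is extended.\<close>

lemma wedge_right_cosets:
  assumes "anti N w"
  shows "wedge_right n v N j w =
    scl (1 / qnum_minus v (Suc N)) (\<Sum>i\<le>N. scl (u ^ (N - i)) (foldr T [i..<N] (app j w)))"
proof -
  note w = antiD[OF assms]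
  have h: "hecke_w n v (Suc N) (cyc N i \<circ> p) (app j w) = scl (u ^ ninv N p) (foldr T [i..<N] (app j w))"
    if ip: "i \<le> N" "p permutes {..<N}" for i p
  proof -
    obtain us where us: "reduced_word N p us" using exists_reduced_word[OF ip(2)] by blast
    then have l: "us \<in> words N" "length us = ninv N p" using ip by (auto simp: reduced_word_iff)
    have pp: "cyc N i \<circ> p permutes {..<Suc N}"
      using ip by (intro permutes_compose permutes_Suc cyc_permutes) auto
    have "hecke_w n v (Suc N) (cyc N i \<circ> p) (app j w) = foldr T [i..<N] (foldr T us (app j w))"
      using hecke_w_reduced[OF n v0 pp reduced_cyc[OF ip(2,1) us]] w by simp
    also have "foldr T us (app j w) = scl (u ^ ninv N p) (app j w)"
      using app_foldr[OF w l(1), of j n v] antisymmetric_foldr[OF assms l(1)] l(2)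
      by (simp add: lin_scl[OF lin_app])
    finally show ?thesis by (simp only: lin_scl[OF lin_foldr[OF lin_hecke_op]])
  qed
  have "asum n v (Suc N) (app j w) =
      (\<Sum>i\<le>N. \<Sum>p\<in>Perms N. scl (u ^ (2 * ninv N p)) (scl (u ^ (N - i)) (foldr T [i..<N] (app j w))))"
    unfolding asum_def sum_Perms_Suc
    by (intro sum.cong refl) (simp only: mem_Collect_eq atMost_iff ninv_cyc h scl_simps power_add mult_2 mult_2_right mult_ac)
  also have "\<dots> = scl (qf N) (\<Sum>i\<le>N. scl (u ^ (N - i)) (foldr T [i..<N] (app j w)))"
    by (simp only: scl_sum_left[symmetric] poincare scl_sum)
  \<comment> \<open>Of the normalization [N+1]!^- the factor [N]!^- is consumed by the sum over S_N,
    leaving 1/[N+1]^-.\<close>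
  finally show ?thesis
    using w qf_neq[of N] by (simp add: wedge_right_eq[OF assms] antisym_eq[OF n] qf_Suc)
qed

end

subsection \<open>Extracting the first factor\<close>

text \<open>Undoes the sign in \<open>Phi_star\<close>: \<open>a\<close> is the index that is
  removed.\<close>

abbreviation front :: "int \<Rightarrow> tensor \<Rightarrow> tensor" where
  "front a \<equiv> Phi_star (- a)"

lemma lookup_Phi_star: "Poly_Mapping.lookup (Phi_star k w) s = Poly_Mapping.lookup w ((- k) # s)"
proof -
  have fin: "finite {s. (- k) # s \<in> Poly_Mapping.keys w}"
    using finite_vimageI[of "Poly_Mapping.keys w" "(#) (- k)"] by (simp add: vimage_def)
  have "Poly_Mapping.lookup (Phi_star k w) s =
    (\<Sum>s'\<in>{s. (- k) # s \<in> Poly_Mapping.keys w}. if s' = s then Poly_Mapping.lookup w ((- k) # s) else 0)"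
    unfolding Phi_star_def lookup_sum_tensor by (rule sum.cong) (auto simp: lookup_basis)
  then show ?thesis using fin by (simp add: sum.delta in_keys_iff)
qed

lemma lookup_front [simp]: "Poly_Mapping.lookup (front a w) s = Poly_Mapping.lookup w (a # s)"
  by (simp add: lookup_Phi_star)

lemma lin_Phi_star [simp]: "lin (Phi_star k)"
  by (rule linI) (auto intro!: tensor_eqI simp: lookup_Phi_star lookup_add)

lemma front_basis: "front a (basis (b # t)) = (if a = b then basis t else 0)"
  by (rule tensor_eqI) (auto simp: lookup_basis)

lemma supp_front: "x \<in> supp A \<Longrightarrow> front a x \<in> supp {s. a # s \<in> A}"
  by (auto simp: supp_def in_keys_iff)

lemma tens_front: "x \<in> tens (Suc N) \<Longrightarrow> front a x \<in> tens N"
  unfolding tens_supp using supp_front[of x "{t. length t = Suc N}" a] by simp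

lemma tens_Suc_eqI:
  assumes "x \<in> tens (Suc N)" "lin f" "lin g"
    and "\<And>b t. length t = N \<Longrightarrow> f (basis (b # t)) = g (basis (b # t))"
  shows "f x = g x"
  using assms(1-3) by (rule tens_eqI) (auto simp: length_Suc_conv assms(4))

lemmas lin_front_intros = lin_intros lin_comp[OF lin_Phi_star] lin_comp[OF lin_app] lin_comp[OF lin_con]

lemma front_hecke_op:
  assumes "x \<in> tens (Suc N)"
  shows "front a (hecke_op n v (Suc i) x) = hecke_op n v i (front a x)"
proof (rule tens_Suc_eqI[OF assms])
  fix b and t :: "int list"
  show "front a (hecke_op n v (Suc i) (basis (b # t))) = hecke_op n v i (front a (basis (b # t)))"
    by (auto simp: hecke_op_basis hecke_basis_sum lin_sum[OF lin_Phi_star] lin_scl[OF lin_Phi_star]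
        front_basis lin_zero[OF lin_hecke_op])
qed (intro lin_front_intros)+

lemma front_app:
  assumes "x \<in> tens (Suc N)"
  shows "front a (app j x) = app j (front a x)"
proof (rule tens_Suc_eqI[OF assms])
  fix b and t :: "int list"
  show "front a (app j (basis (b # t))) = app j (front a (basis (b # t)))"
    by (auto simp: front_basis lin_zero[OF lin_app])
qed (intro lin_front_intros)+

lemma front_foldr:
  "x \<in> tens (Suc N) \<Longrightarrow>
    front a (foldr (hecke_op n v) (map Suc us) x) = foldr (hecke_op n v) us (front a x)"
  by (induction us) (auto simp: front_hecke_op[OF tens_foldr])

text \<open>The generators from the second position on never touch the first factor, so their
  eigenvalue equations pass to the remaining factors. Hence \<open>Phi_star\<close> maps wedges to
  wedges.\<close>

lemma antisymmetric_front:
  assumes "antisymmetric n v (Suc N) w"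
  shows "antisymmetric n v N (front a w)"
proof -
  have "w \<in> tens (Suc N)" using assms by (simp add: antisymmetric_def)
  moreover have "hecke_op n v (Suc i) w = scl (- inverse v) w" if "Suc i < N" for i
    using assms that by (simp add: antisymmetric_def)
  ultimately show ?thesis
    using front_hecke_op[of w N a n v, symmetric]
    by (simp add: antisymmetric_def tens_front lin_scl[OF lin_Phi_star])
qed

section \<open>Extremal keys of antisymmetric tensors\<close>

lemma lookup_hecke_op_basis:
  assumes "Suc i < length r"
  shows "Poly_Mapping.lookup (hecke_op n v i (basis r)) s =
    (if s = r[i := s ! i, Suc i := r ! i + r ! Suc i - s ! i] \<and>
        min (r ! i) (r ! Suc i) \<le> s ! i \<and> s ! i \<le> max (r ! i) (r ! Suc i)
     then hcoef n v (r ! i) (r ! Suc i) (s ! i) else 0)"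
proof -
  have *: "r[i := x, Suc i := r ! i + r ! Suc i - x] = s \<longleftrightarrow>
      x = s ! i \<and> s = r[i := s ! i, Suc i := r ! i + r ! Suc i - s ! i]" for x
    using assms by auto
  have "Poly_Mapping.lookup (hecke_op n v i (basis r)) s =
    (\<Sum>x\<in>{min (r ! i) (r ! Suc i)..max (r ! i) (r ! Suc i)}.
       if x = s ! i then (if s = r[i := s ! i, Suc i := r ! i + r ! Suc i - s ! i]
         then hcoef n v (r ! i) (r ! Suc i) (s ! i) else 0) else 0)"
    unfolding hecke_op_basis hecke_basis_sum lookup_sum_tensor
    by (rule sum.cong) (auto simp: lookup_basis *)
  then show ?thesis by (simp add: sum.delta)
qed

lemma sum_list_update_int:
  fixes t :: "int list"
  shows "i < length t \<Longrightarrow> sum_list (t[i := x]) = sum_list t - t ! i + x"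
  by (induction t arbitrary: i) (auto split: nat.split)

definition sq_norm :: "int list \<Rightarrow> int" where
  "sq_norm t = sum_list (map (\<lambda>x. x ^ 2) t)"

text \<open>The tie-breaker among keys with maximal sum of squares: swapping an ascent p < q of
  neighbours changes it by p - q < 0, so a minimum has no such ascent.\<close>

definition moment :: "int list \<Rightarrow> int" where
  "moment t = (\<Sum>j<length t. int j * t ! j)"

text \<open>The product is negative for x strictly between the two old entries and zero at both
  ends: a swap keeps the sum of squares, every other new term of T_i lowers it.\<close>

lemma sq_norm_update:
  assumes "Suc i < length t"
  shows "sq_norm (t[i := x, Suc i := t ! i + t ! Suc i - x]) = sq_norm t + 2 * ((x - t ! i) * (x - t ! Suc i))"
  using assms
  by (simp add: sq_norm_def map_update sum_list_update_int) (simp add: power2_eq_square algebra_simps)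

lemma moment_update:
  assumes "i < length t"
  shows "moment (t[i := x]) = moment t + int i * (x - t ! i)"
proof -
  have "moment (t[i := x]) = (\<Sum>j<length t. int j * t ! j + (if j = i then int i * (x - t ! i) else 0))"
    unfolding moment_def by (rule sum.cong) (auto simp: nth_list_update algebra_simps)
  then show ?thesis using assms by (simp add: sum.distrib sum.delta moment_def)
qed

lemma obtain_max:
  fixes f :: "'a \<Rightarrow> int"
  assumes "finite S" "S \<noteq> {}"
  obtains t where "t \<in> S" "\<And>s. s \<in> S \<Longrightarrow> f s \<le> f t"
proof -
  have "Max (f ` S) \<in> f ` S" using assms by (intro Max_in) auto
  then obtain t where "t \<in> S" "Max (f ` S) = f t" by auto
  then show ?thesis using that assms by (metis Max_ge finite_imageI imageI)
qed

text \<open>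
  Spreading the entries of a key apart increases the sum of squares, so on the keys where that sum
  is maximal the operators act by swaps with nonzero coefficients only.
\<close>

lemma (in generic_hecke) strictly_decreasing_key:
  assumes y: "anti N y" and "y \<noteq> 0"
  obtains t where "t \<in> Poly_Mapping.keys y" "\<And>i. Suc i < N \<Longrightarrow> t ! Suc i < t ! i"
proof -
  let ?S = "Poly_Mapping.keys y"
  have len: "length t = N" if "t \<in> ?S" for t
    using that y by (auto simp: antisymmetric_def tens_def)
  obtain t0 where t0: "t0 \<in> ?S" "\<And>s. s \<in> ?S \<Longrightarrow> sq_norm s \<le> sq_norm t0"
    using obtain_max[of ?S sq_norm] \<open>y \<noteq> 0\<close> by auto
  let ?S' = "{s \<in> ?S. sq_norm s = sq_norm t0}"
  obtain t where t: "t \<in> ?S'" "\<And>s. s \<in> ?S' \<Longrightarrow> - moment s \<le> - moment t"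
    using obtain_max[of ?S' "\<lambda>s. - moment s"] t0(1) by auto
  have lt: "length t = N" and tS: "t \<in> ?S" using t(1) len by auto
  have mx: "sq_norm s \<le> sq_norm t" if "s \<in> ?S" for s
    using t0(2)[OF that] t(1) by simp
  have "t ! Suc i < t ! i" if i: "Suc i < N" for i
  proof (rule ccontr)
    assume asc: "\<not> t ! Suc i < t ! i"
    define p q where "p = t ! i" and "q = t ! Suc i"
    have pq: "p \<le> q" using asc by (simp add: p_def q_def)
    define s where "s = t[i := q, Suc i := p]"
    have s_nth: "s ! i = q" "s ! Suc i = p" "length s = N"
      using i lt by (simp_all add: s_def)
    have s_alt: "s = t[i := q, Suc i := t ! i + t ! Suc i - q]" by (simp add: s_def p_def q_def)
    have sq_s: "sq_norm s = sq_norm t"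
      unfolding s_alt using i lt by (subst sq_norm_update) (auto simp: q_def)
    have ts: "t = s[i := p, Suc i := q]"
      using i lt by (auto simp: s_def p_def q_def list_update_swap[of "Suc i" i])
    \<comment> \<open>A key producing s with q strictly between its own entries would have a larger
      sum of squares than s, against the maximality of t.\<close>
    have only: "r = s \<or> r = t"
      if r: "r \<in> ?S" "Poly_Mapping.lookup (T i (basis r)) s \<noteq> 0" for r
    proof -
      have lr: "length r = N" "Suc i < length r" using len[OF r(1)] i by auto
      have *: "s = r[i := q, Suc i := r ! i + r ! Suc i - q]" "min (r ! i) (r ! Suc i) \<le> q"
        "q \<le> max (r ! i) (r ! Suc i)"
        using r(2) unfolding lookup_hecke_op_basis[OF lr(2)] s_nth by (auto split: if_splits)
      have "sq_norm s = sq_norm r + 2 * ((q - r ! i) * (q - r ! Suc i))"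
        using sq_norm_update[OF lr(2), of q] *(1) by simp
      then have "0 \<le> (q - r ! i) * (q - r ! Suc i)"
        using mx[OF r(1)] sq_s by simp
      then have "q = r ! i \<or> q = r ! Suc i"
        using *(2,3) by (auto simp: zero_le_mult_iff)
      then show ?thesis
      proof
        assume "q = r ! i"
        then have "s = r" using *(1) by simp
        then show ?thesis by simp
      next
        assume q: "q = r ! Suc i"
        have "p = r ! i" using arg_cong[OF *(1), of "\<lambda>s. s ! Suc i"] s_nth lr q by simp
        then have "r = t" unfolding ts *(1) using q
          by (simp add: list_update_swap[of "Suc i" i])
        then show ?thesis by simp
      qed
    qed
    have it: "Suc i < length t" "Suc i < length s" using i lt s_nth by auto
    have Tt: "Poly_Mapping.lookup (T i (basis t)) s = hcoef n v p q q"
      using s_alt pq unfolding lookup_hecke_op_basis[OF it(1)] s_nth by (auto simp: p_def q_def)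
    have Ty: "Poly_Mapping.lookup (T i y) s = u * Poly_Mapping.lookup y s"
      using y i by (simp add: antisymmetric_def)
    have "s \<in> ?S \<and> p < q"
    \<comment> \<open>Equal entries would make v, instead of \<open>u\<close> = -1/v, the eigenvalue
      visible at t, so that v^2 = -1 and v^4 = 1. For p < q the swapped list s turns out to be a key
      as well, with smaller moment.\<close>
    proof (cases "p = q")
      case True
      then have "s = t[i := p, Suc i := q]" by (simp only: s_def)
      then have "s = t" by (simp add: p_def q_def)
      then have "Poly_Mapping.lookup (T i y) s = Poly_Mapping.lookup y s * v"
        using only Tt True by (subst lookup_lin_single[where u = t]) (auto simp: hcoef_def)
      then have "Poly_Mapping.lookup y t * v = Poly_Mapping.lookup y t * u"
        using Ty \<open>s = t\<close> by (simp add: mult.commute)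
      then have "v = u" using tS unfolding mult_cancel_left by (simp add: in_keys_iff)
      then have "v * v = u * v" by (rule arg_cong)
      also have "u * v = - 1" using v0 by simp
      finally have "v ^ 2 = - 1" by (simp only: power2_eq_square)
      then have "(v ^ 2) ^ 2 = 1" by simp
      then have "v ^ 4 = 1" unfolding power_mult[symmetric] by simp
      then show ?thesis using generic[of 4] by simp
    next
      case False
      then have "p < q" using pq by simp
      \<comment> \<open>The descent s has no diagonal term, so the coefficient of s in T_i y comes
        from t alone and is nonzero.\<close>
      have "Poly_Mapping.lookup (T i (basis s)) s = 0"
        using \<open>p < q\<close> unfolding lookup_hecke_op_basis[OF it(2)] s_nth by (simp add: hcoef_def)
      then have "Poly_Mapping.lookup (T i y) s = Poly_Mapping.lookup y t * hcoef n v p q q"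
        using only Tt by (subst lookup_lin_single[where u = t]) auto
      moreover have "hcoef n v p q q \<noteq> 0" using \<open>p < q\<close> v0 by (simp add: hcoef_def)
      ultimately have "Poly_Mapping.lookup y s \<noteq> 0" using Ty tS by (auto simp: in_keys_iff)
      then show ?thesis using \<open>p < q\<close> by (simp add: in_keys_iff)
    qed
    then have "s \<in> ?S'" "p < q" using sq_s t(1) by auto
    moreover have "moment s = moment t + p - q"
      unfolding s_def using i lt
      by (simp add: moment_update) (simp add: p_def q_def algebra_simps)
    ultimately show False using t(2)[of s] by simp
  qed
  then show ?thesis using that tS by blast
qed

section \<open>Bounds on indices and degree\<close>

lemma sum_list_decreasing:
  fixes t :: "int list"
  assumes "\<And>i. Suc i < length t \<Longrightarrow> t ! Suc i < t ! i" "t \<noteq> [] \<Longrightarrow> hd t \<le> c"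
  shows "sum_list t \<le> (\<Sum>i<length t. c - int i)"
  using assms
proof (induction t arbitrary: c)
  case (Cons a t)
  have "sum_list t \<le> (\<Sum>i<length t. (c - 1) - int i)"
  proof (rule Cons.IH)
    show "t ! Suc i < t ! i" if "Suc i < length t" for i
      using Cons.prems(1)[of "Suc i"] that by simp
    show "hd t \<le> c - 1" if "t \<noteq> []"
      using Cons.prems(1)[of 0] Cons.prems(2) that by (cases t) auto
  qed
  moreover have "(\<Sum>i<length (a # t). c - int i) = c + (\<Sum>i<length t. (c - 1) - int i)"
    by (simp add: sum.lessThan_Suc_shift sum_subtractf sum.distrib algebra_simps)
  ultimately show ?case
    using Cons.prems(2) by simp
qed simp

text \<open>Both bounds survive T_i: the new entries stay between the old ones and the sum of the
  entries is conserved.\<close>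

definition bounded_keys :: "int \<Rightarrow> int \<Rightarrow> nat \<Rightarrow> int list set" where
  "bounded_keys c l N = {t. length t = N \<and> (\<forall>x\<in>set t. x \<le> c) \<and> l \<le> sum_list t}"

lemma bounded_keys_update:
  assumes "t \<in> bounded_keys c l N" "Suc i < N" "min (t ! i) (t ! Suc i) \<le> y" "y \<le> max (t ! i) (t ! Suc i)"
  shows "t[i := y, Suc i := t ! i + t ! Suc i - y] \<in> bounded_keys c l N"
proof -
  have t: "length t = N" "\<And>x. x \<in> set t \<Longrightarrow> x \<le> c" "l \<le> sum_list t"
    using assms(1) by (auto simp: bounded_keys_def)
  have "t ! i \<le> c" "t ! Suc i \<le> c" using t assms(2) by auto
  then have y: "y \<le> c" "t ! i + t ! Suc i - y \<le> c" using assms(3,4) by auto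
  have "x \<le> c" if "x \<in> set (t[i := y, Suc i := t ! i + t ! Suc i - y])" for x
    using set_mp[OF set_update_subset_insert that] set_mp[OF set_update_subset_insert, of x t i y] y t(2) by auto
  then show ?thesis
    using t assms(2) by (simp add: bounded_keys_def sum_list_update_int)
qed

lemma bounded_hecke_op:
  "x \<in> supp (bounded_keys c l N) \<Longrightarrow> Suc i < N \<Longrightarrow> hecke_op n v i x \<in> supp (bounded_keys c l N)"
  by (rule supp_hecke_op) (auto intro: bounded_keys_update)

lemma bounded_foldr:
  "x \<in> supp (bounded_keys c l N) \<Longrightarrow> us \<in> words N \<Longrightarrow>
    foldr (hecke_op n v) us x \<in> supp (bounded_keys c l N)"
  by (induction us) (auto intro: bounded_hecke_op)

lemma bounded_keys_mono:
  "x \<in> supp (bounded_keys c l N) \<Longrightarrow> c \<le> c' \<Longrightarrow> l' \<le> l \<Longrightarrow> x \<in> supp (bounded_keys c' l' N)"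
  by (force simp: supp_def bounded_keys_def)

lemma bounded_front:
  "x \<in> supp (bounded_keys c l (Suc N)) \<Longrightarrow> front a x \<in> supp (bounded_keys c (l - a) N)"
  by (drule supp_front[of _ _ a]) (auto simp: supp_def bounded_keys_def)

lemma bounded_app:
  "x \<in> supp (bounded_keys c l N) \<Longrightarrow> app j x \<in> supp (bounded_keys (max c j) (l + j) (Suc N))"
  by (rule supp_image[OF lin_app]) (auto simp: supp_basis bounded_keys_def)

lemma obtain_bounded_keys:
  assumes "x \<in> tens N"
  obtains c l where "x \<in> supp (bounded_keys c l N)"
proof
  let ?K = "Poly_Mapping.keys x"
  have "finite (\<Union>t\<in>?K. set t)" by simp
  then have "y \<le> Max (\<Union>t\<in>?K. set t)" if "t \<in> ?K" "y \<in> set t" for t y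
    using that by (intro Max_ge) auto
  moreover have "Min (sum_list ` ?K) \<le> sum_list t" if "t \<in> ?K" for t
    using that by (intro Min_le) auto
  \<comment> \<open>If a maximum or minimum over an empty set occurs, its value is arbitrary, but
    then there is no entry or no key to bound.\<close>
  ultimately show "x \<in> supp (bounded_keys (Max (\<Union>t\<in>?K. set t)) (Min (sum_list ` ?K)) N)"
    using assms by (auto simp: supp_def bounded_keys_def tens_def)
qed

section \<open>Moving the largest index to the front\<close>

definition diag_coeff :: "nat \<Rightarrow> complex \<Rightarrow> int \<Rightarrow> int \<Rightarrow> complex" where
  "diag_coeff n v b a = (if int n dvd b - a then v else 1)"

text \<open>Moving \<open>e\<^sub>b\<close> from the last to the first position past smaller indices multiplies by this operator.\<close>

definition diag :: "nat \<Rightarrow> complex \<Rightarrow> int \<Rightarrow> tensor \<Rightarrow> tensor" where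
  "diag n v b = lin_ext (\<lambda>t. scl (prod_list (map (diag_coeff n v b) t)) (basis t))"

lemma lin_diag [simp]: "lin (diag n v b)"
  by (simp add: diag_def)

lemma diag_basis: "diag n v b (basis t) = scl (prod_list (map (diag_coeff n v b) t)) (basis t)"
  by (simp add: diag_def)

lemma front_diag:
  assumes "x \<in> tens (Suc N)"
  shows "front a (diag n v b x) = scl (diag_coeff n v b a) (diag n v b (front a x))"
proof (rule tens_Suc_eqI[OF assms])
  fix c and t :: "int list"
  show "front a (diag n v b (basis (c # t))) = scl (diag_coeff n v b a) (diag n v b (front a (basis (c # t))))"
    by (auto simp: diag_basis front_basis lin_scl[OF lin_Phi_star] lin_zero[OF lin_diag])
qed (intro lin_front_intros lin_comp[OF lin_diag] lin_diag)+

text \<open>The origin of \<open>diag_coeff\<close>: it is the coefficient of the swapped term when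
  T_i acts on the ascent e_a \<otimes> e_b.\<close>

lemma hcoef_second: "a < b \<Longrightarrow> hcoef n v a b b = diag_coeff n v b a"
  by (simp add: hcoef_def diag_coeff_def)

text \<open>T_0 applied to e_a \<otimes> e_c yields first indices between a and c. As a < b and c
  \<le> b, the index b arises only for c = b, from the swapped term.\<close>

lemma front_hecke_op_con:
  assumes "x \<in> supp {t. length t = Suc N \<and> (\<forall>y\<in>set t. y \<le> b)}" "a < b"
  shows "front b (hecke_op n v 0 (con a x)) = scl (diag_coeff n v b a) (con a (front b x))"
proof (rule lin_eq_supp[OF _ _ assms(1)])
  fix t :: "int list" assume "t \<in> {t. length t = Suc N \<and> (\<forall>y\<in>set t. y \<le> b)}"
  then obtain c s where t: "t = c # s" "c \<le> b" by (auto simp: length_Suc_conv)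
  show "front b (hecke_op n v 0 (con a (basis t))) = scl (diag_coeff n v b a) (con a (front b (basis t)))"
  proof (rule tensor_eqI)
    fix r
    show "Poly_Mapping.lookup (front b (hecke_op n v 0 (con a (basis t)))) r =
        Poly_Mapping.lookup (scl (diag_coeff n v b a) (con a (front b (basis t)))) r"
      using t assms(2)
      by (cases "c = b")
         (auto simp: lookup_hecke_op_basis front_basis hcoef_second lookup_basis lin_zero[OF lin_con])
  qed
qed (intro lin_front_intros lin_front_intros)+

text \<open>A pair with entries at most b yields the pair (b, a) only if it is (a, b) or (b, a). The
  latter is a descent and has no diagonal term, which leaves the swap of (a, b).\<close>

lemma front_front_hecke_op:
  assumes "x \<in> supp {t. length t = Suc (Suc N) \<and> (\<forall>y\<in>set t. y \<le> b)}" "a < b"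
  shows "front a (front b (hecke_op n v 0 x)) = scl (diag_coeff n v b a) (front b (front a x))"
proof (rule lin_eq_supp[OF _ _ assms(1)])
  fix t :: "int list" assume "t \<in> {t. length t = Suc (Suc N) \<and> (\<forall>y\<in>set t. y \<le> b)}"
  then obtain c d s where t: "t = c # d # s" "c \<le> b" "d \<le> b" by (auto simp: length_Suc_conv)
  show "front a (front b (hecke_op n v 0 (basis t))) = scl (diag_coeff n v b a) (front b (front a (basis t)))"
  proof (rule tensor_eqI)
    fix r
    show "Poly_Mapping.lookup (front a (front b (hecke_op n v 0 (basis t)))) r =
        Poly_Mapping.lookup (scl (diag_coeff n v b a) (front b (front a (basis t)))) r"
      using t assms(2)
      by (cases "d = b"; cases "c = b")
         (auto simp: lookup_hecke_op_basis hcoef_second lookup_basis, auto simp: hcoef_def)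
  qed
qed (intro lin_front_intros lin_front_intros)+

lemma front_foldr_app:
  assumes "\<forall>y\<in>set t. y < b"
  shows "front b (foldr (hecke_op n v) [0..<length t] (app b (basis t))) = diag n v b (basis t)"
  using assms
proof (induction t)
  case Nil
  show ?case by (simp add: front_basis diag_basis)
next
  case (Cons a t)
  let ?y = "foldr (hecke_op n v) [0..<length t] (app b (basis t))"
  have "app b (basis t) \<in> supp (bounded_keys b (sum_list t + b) (Suc (length t)))"
    using Cons.prems by (auto simp: supp_basis bounded_keys_def)
  then have "?y \<in> supp (bounded_keys b (sum_list t + b) (Suc (length t)))"
    by (rule bounded_foldr) (auto simp: words_def)
  then have y: "?y \<in> supp {s. length s = Suc (length t) \<and> (\<forall>y\<in>set s. y \<le> b)}"
    by (auto simp: supp_def bounded_keys_def)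
  \<comment> \<open>All generators but T_0 act on the tail \<open>t\<close> together with e_b, where
    the induction hypothesis applies; T_0 then moves e_b past e_a.\<close>
  have "[0..<length (a # t)] = 0 # map Suc [0..<length t]"
    by (simp add: map_Suc_upt upt_conv_Cons del: upt_Suc)
  then have "foldr (hecke_op n v) [0..<length (a # t)] (app b (basis (a # t))) =
      hecke_op n v 0 (con a ?y)"
    using con_foldr[of "app b (basis t)" "Suc (length t)" a n v "[0..<length t]"] by simp
  then have "front b (foldr (hecke_op n v) [0..<length (a # t)] (app b (basis (a # t)))) =
      scl (diag_coeff n v b a) (con a (front b ?y))"
    using front_hecke_op_con[OF y] Cons.prems by simp
  also have "front b ?y = diag n v b (basis t)"
    using Cons by simp
  finally show ?case
    by (simp add: diag_basis lin_scl[OF lin_con])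
qed

context generic_hecke
begin

lemma anti_front: "anti (Suc N) w \<Longrightarrow> anti N (front a w)"
  by (rule antisymmetric_front)

text \<open>In the sum over cosets the terms with i > 0 leave the first factor alone, whose index is
  below b. Only i = 0 remains, with its coefficient \<open>u\<close>^N.\<close>

lemma front_wedge_right_top:
  assumes w: "anti N w" and b: "w \<in> supp {t. length t = N \<and> (\<forall>y\<in>set t. y < b)}"
  shows "front b (wedge_right n v N b w) = scl (u ^ N / qnum_minus v (Suc N)) (diag n v b w)"
proof -
  have zero: "front b (foldr T [i..<N] (app b w)) = 0" if i: "0 < i" "i \<le> N" for i
  proof -
    obtain M where M: "N = Suc M" using i by (cases N) auto
    have "[i..<N] = map Suc [i - 1..<M]"
      using i M by (simp add: map_Suc_upt)
    then have "front b (foldr T [i..<N] (app b w)) = foldr T [i - 1..<M] (front b (app b w))"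
      using front_foldr[OF tens_app[OF antiD[OF w]], of b n v] M by simp
    also have "front b (app b w) = app b (front b w)"
      using front_app antiD[OF w] M by simp
    also have "front b w = 0"
      using b by (intro tensor_eqI) (force simp: supp_def in_keys_iff)
    finally show ?thesis by (simp add: lin_zero[OF lin_app] lin_zero[OF lin_foldr[OF lin_hecke_op]])
  qed
  have top: "front b (foldr T [0..<N] (app b w)) = diag n v b w"
  proof (rule lin_eq_supp[OF _ _ b])
    show "lin (\<lambda>w. front b (foldr T [0..<N] (app b w)))"
      by (intro lin_comp[OF lin_Phi_star] lin_comp[OF lin_foldr[OF lin_hecke_op]] lin_app)
  qed (use front_foldr_app in auto)
  have "(\<Sum>i\<le>N. scl (u ^ (N - i)) (front b (foldr T [i..<N] (app b w)))) =
      (\<Sum>i\<le>N. if i = 0 then scl (u ^ N) (diag n v b w) else 0)"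
    by (rule sum.cong) (auto simp: zero top)
  then show ?thesis
    by (simp add: wedge_right_cosets[OF w] lin_scl[OF lin_Phi_star] lin_sum[OF lin_Phi_star] sum.delta)
qed

lemma bounded_wedge_right:
  assumes "anti N w" "w \<in> supp (bounded_keys c l N)"
  shows "wedge_right n v N j w \<in> supp (bounded_keys (max c j) (l + j) (Suc N))"
  unfolding wedge_right_cosets[OF assms(1)]
  by (intro supp_scl supp_sum bounded_foldr bounded_app assms(2)) (auto simp: words_def)

lemma diag_coeff_neq: "diag_coeff n v b a \<noteq> 0"
  using v0 by (simp add: diag_coeff_def)

text \<open>The eigenvalue equation for T_0 exchanges the order of extraction at the price of one
  factor \<open>u\<close> and reduces to \<open>front_wedge_right_top\<close>. The coefficient
  \<open>diag_coeff\<close> appears on both sides, here from T_0 and there from \<open>diag\<close>,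
  and cancels.\<close>

lemma front_wedge_right_second:
  assumes w: "anti (Suc N) w" and b: "w \<in> supp (bounded_keys (b - 1) l (Suc N))" and a: "a < b"
  shows "front b (front a (wedge_right n v (Suc N) b w)) =
    scl (u ^ (N + 2) / qnum_minus v (Suc (Suc N))) (diag n v b (front a w))"
proof -
  let ?z = "wedge_right n v (Suc N) b w" and ?d = "diag_coeff n v b a" and ?q = "qnum_minus v (Suc (Suc N))"
  have z: "?z \<in> supp {t. length t = Suc (Suc N) \<and> (\<forall>y\<in>set t. y \<le> b)}"
    using bounded_wedge_right[OF w b, of b] by (auto simp: supp_def bounded_keys_def)
  have w': "w \<in> supp {t. length t = Suc N \<and> (\<forall>y\<in>set t. y < b)}"
    using b by (force simp: supp_def bounded_keys_def)
  have "T 0 ?z = scl u ?z"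
    using anti_wedge_right[OF w] by (simp add: antisymmetric_def)
  then have "scl ?d (front b (front a ?z)) = scl u (front a (front b ?z))"
    using front_front_hecke_op[OF z a, of n v] by (simp add: lin_scl[OF lin_Phi_star])
  also have "front b ?z = scl (u ^ Suc N / ?q) (diag n v b w)"
    by (rule front_wedge_right_top[OF w w'])
  also have "scl u (front a (scl (u ^ Suc N / ?q) (diag n v b w))) =
      scl ?d (scl (u ^ (N + 2) / ?q) (diag n v b (front a w)))"
    using front_diag[OF antiD[OF w]] by (simp add: lin_scl[OF lin_Phi_star] mult.commute mult.left_commute)
  finally show ?thesis
    using diag_coeff_neq[of b a] by (metis scl_eq_iff scl_simps(2,4) left_inverse)
qed

text \<open>Read backwards, b - 1, b - 2, ... with b = N - m are the indices j - m, j < N, of the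
  factors appended by the transition maps.\<close>

lemma sum_staircase: "(\<Sum>i<N. (int N - m) - 1 - int i) = (\<Sum>j<N. int j - m)"
  by (rule sum.reindex_bij_witness[of _ "\<lambda>j. N - 1 - j" "\<lambda>i. N - 1 - i"]) auto

text \<open>One step of the stabilization. The number \<open>l\<close> is the excess of the degree
  over the staircase, which the transition maps do not change. The hypothesis \<open>k\<close> puts
  the removed index below the appended one, and \<open>large\<close> makes the degree of the
  difference exceed the staircase.\<close>

lemma Phi_tilde_star_wedge:
  assumes w: "anti (Suc N) w"
    and b: "w \<in> supp (bounded_keys (int (Suc N) - m - 1) (l + (\<Sum>j<Suc N. int j - m)) (Suc N))"
    and k: "- k < int (Suc N) - m" and large: "0 < l + k + (int (Suc N) - m)"
  shows "Phi_tilde_star v k (Suc (Suc N)) (wedge_right n v (Suc N) (int (Suc N) - m) w) =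
    wedge_right n v N (int (Suc N) - m) (Phi_tilde_star v k (Suc N) w)"
proof -
  define B where "B = int (Suc N) - m"
  define a where "a = - k"
  define \<sigma> where "\<sigma> = (\<Sum>j<Suc N. int j - m)"
  let ?z = "wedge_right n v (Suc N) B w"
  let ?q = "qnum_plus v (Suc (Suc N))" and ?q' = "qnum_plus v (Suc N)"
  define y where "y = scl ?q (front a ?z) - scl ?q' (wedge_right n v N B (front a w))"
  have bw: "w \<in> supp (bounded_keys (B - 1) (l + \<sigma>) (Suc N))" and aB: "a < B"
    using b k by (simp_all add: B_def \<sigma>_def a_def)
  have fw: "anti N (front a w)" using anti_front[OF w] .
  have bfw: "front a w \<in> supp (bounded_keys (B - 1) (l + \<sigma> - a) N)"
    using bounded_front[OF bw] .
  have zw: "anti (Suc N) (front a ?z)" by (intro anti_front anti_wedge_right w)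
  have fz: "anti (Suc N) (wedge_right n v N B (front a w))" by (intro anti_wedge_right fw)
  have ay: "anti (Suc N) y"
    unfolding y_def
    by (rule antisymmetric_lin(2)[OF antisymmetric_lin(3)[OF zw zw] antisymmetric_lin(3)[OF fz fz]])
  have bdy: "y \<in> supp (bounded_keys B (l + \<sigma> - a + B) (Suc N))"
    unfolding y_def
    using bounded_front[OF bounded_wedge_right[OF w bw, of B], of a] bounded_wedge_right[OF fw bfw, of B]
    by (intro supp_diff supp_scl) (simp_all add: max_def algebra_simps)
  have "front B (wedge_right n v N B (front a w)) = scl (u ^ N / qnum_minus v (Suc N)) (diag n v B (front a w))"
    by (rule front_wedge_right_top[OF fw]) (use bfw in \<open>force simp: supp_def bounded_keys_def\<close>)
  then have "front B y = scl (?q * (u ^ (N + 2) / qnum_minus v (Suc (Suc N))) - ?q' * (u ^ N / qnum_minus v (Suc N)))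
      (diag n v B (front a w))"
    unfolding y_def using front_wedge_right_second[OF w bw aB]
    by (simp add: lin_diff[OF lin_Phi_star] lin_scl[OF lin_Phi_star] scl_distrib)
  also have "?q * (u ^ (N + 2) / qnum_minus v (Suc (Suc N))) = v ^ (2 * Suc N) * u ^ (N + 2)"
    using qnum_minus_neq[of "Suc (Suc N)"] by (simp add: qnum_plus_minus)
  also have "?q' * (u ^ N / qnum_minus v (Suc N)) = v ^ (2 * N) * u ^ N"
    using qnum_minus_neq[of "Suc N"] by (simp add: qnum_plus_minus)
  \<comment> \<open>The two extra factors \<open>u\<close>, one from the longer coset representative
    and one from the exchange by T_0, are balanced by v^2. This is the effect of the scaling by
    [N]^+.\<close>
  also have "v ^ (2 * Suc N) * u ^ (N + 2) = v ^ (2 * N) * u ^ N"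
  proof -
    have vv: "v * (inverse v * c) = c" for c using v0 by simp
    show ?thesis using v0 by (simp add: power2_eq_square vv)
  qed
  finally have top: "front B y = 0" by simp
  have "y = 0"
  proof (rule ccontr)
    assume "y \<noteq> 0"
    then obtain t where t: "t \<in> Poly_Mapping.keys y" "\<And>i. Suc i < Suc N \<Longrightarrow> t ! Suc i < t ! i"
      using strictly_decreasing_key[OF ay] by blast
    have tb: "length t = Suc N" "\<forall>x\<in>set t. x \<le> B" "l + \<sigma> - a + B \<le> sum_list t"
      using bdy t(1) by (auto simp: supp_def bounded_keys_def)
    obtain h s where hs: "t = h # s" using tb(1) by (cases t) auto
    \<comment> \<open>Keys starting with B are excluded by \<open>top\<close>, so the strictly
      decreasing list starts at B - 1 or below.\<close>
    have "h \<noteq> B"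
    proof
      assume "h = B"
      then have "Poly_Mapping.lookup (front B y) s = Poly_Mapping.lookup y t" by (simp add: hs)
      then show False using top t(1) by (simp add: in_keys_iff)
    qed
    then have "sum_list t \<le> (\<Sum>i<length t. (B - 1) - int i)"
      using t(2) tb by (intro sum_list_decreasing) (auto simp: hs)
    \<comment> \<open>The upper bound is \<sigma>, while the lower bound for keys of y exceeds
      \<sigma> by l + k + B > 0.\<close>
    also have "\<dots> = \<sigma>" using sum_staircase[of "Suc N" m] tb(1) by (simp add: B_def \<sigma>_def)
    finally show False using tb(3) large by (simp add: a_def B_def)
  qed
  then have "scl ?q (front a ?z) = scl ?q' (wedge_right n v N B (front a w))"
    by (simp add: y_def)
  also have "\<dots> = wedge_right n v N B (scl ?q' (front a w))"
    using wedge_right_lin(2)[OF fw fw] by simp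
  finally show ?thesis by (simp add: Phi_tilde_star_def a_def B_def)
qed

section \<open>Transition maps and stabilization\<close>

lemma phi_refl: "phi n v m N N w = w"
  by (simp add: phi_def)

lemma phi_Suc: "N \<le> R \<Longrightarrow> phi n v m (Suc R) N w = wedge_right n v R (int R - m) (phi n v m R N w)"
  by (simp add: phi_def)

lemma anti_phi:
  assumes "anti N w" "N \<le> R"
  shows "anti R (phi n v m R N w)"
  using assms(2)
proof (induction R rule: dec_induct)
  case base
  show ?case using assms(1) by (simp add: phi_refl)
next
  case (step R)
  then show ?case by (simp add: phi_Suc anti_wedge_right)
qed

text \<open>Appending e_{R-m} raises the degree by the next term of the staircase, so the excess
  over the staircase stays constant; once R is large, the last appended index is the bound for all
  entries.\<close>

lemma bounded_phi:
  assumes "anti N w" "w \<in> supp (bounded_keys c l N)" "N \<le> R"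
  shows "phi n v m R N w \<in>
    supp (bounded_keys (max c (int R - m - 1)) (l - (\<Sum>j<N. int j - m) + (\<Sum>j<R. int j - m)) R)"
  using assms(3)
proof (induction R rule: dec_induct)
  case base
  show ?case using assms(2) bounded_keys_mono by (force simp: phi_refl)
next
  case (step R)
  have "phi n v m (Suc R) N w \<in> supp (bounded_keys (max (max c (int R - m - 1)) (int R - m))
      (l - (\<Sum>j<N. int j - m) + (\<Sum>j<R. int j - m) + (int R - m)) (Suc R))"
    using bounded_wedge_right[OF anti_phi[OF assms(1) step.hyps(1)] step.IH, of "int R - m"] step.hyps
    by (simp add: phi_Suc)
  then show ?case
    by (rule bounded_keys_mono) auto
qed

end

theorem proposition5p10:
  fixes n :: nat and v :: complex and m k :: int
  assumes "n \<ge> 1"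
    and "v \<noteq> 0"
    and "\<forall>r::nat. r \<ge> 1 \<longrightarrow> v ^ r \<noteq> 1"
  shows "stabilizes n v m 1 (Phi n v k) \<and> stabilizes n v m (-1) (Phi_tilde_star v k)"
proof
  interpret generic_hecke n v
    by unfold_locales (use assms in auto)
  show "stabilizes n v m 1 (Phi n v k)"
    unfolding stabilizes_def
  proof (intro conjI allI impI ballI)
    fix N :: nat
    have "nat (int N + 1) = Suc N" by simp
    then show "linear_between (Wedge n v N) (Wedge n v (nat (int N + 1))) (Phi n v k N)"
      by (auto simp: linear_between_def Wedge_iff Phi_def anti_wedge_left wedge_left_lin)
  next
    fix l w assume "w \<in> Wedge n v l"
    then have w: "anti l w" by (simp add: Wedge_iff)
    have "phi n v (m + 1) (Suc (N + r)) (Suc N) (Phi n v k N (phi n v m N l w)) =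
        Phi n v k (N + r) (phi n v m (N + r) l w)" if "l \<le> N" for N r
    proof (induction r)
      case (Suc r)
      \<comment> \<open>The shifts agree: with m + 1 the vector appended to N + r + 1 factors has
        index (N + r + 1) - (m + 1) = (N + r) - m. So every step is one use of
        \<open>wedge_left_right\<close>, and M = l suffices.\<close>
      then show ?case
        using wedge_left_right[OF anti_phi[OF w, of "N + r" m]] that
        by (simp add: phi_Suc Phi_def add_diff_eq)
    qed (simp add: phi_refl)
    moreover have "nat (int N + 1) = Suc N" for N by simp
    ultimately show "\<exists>M\<ge>l. \<forall>N>M. \<forall>r. phi n v (m + 1) (nat (int (N + r) + 1)) (nat (int N + 1))
        (Phi n v k N (phi n v m N l w)) = Phi n v k (N + r) (phi n v m (N + r) l w)"
      by (intro exI[of _ l]) (simp only: less_imp_le order.refl simp_thms, blast intro: less_imp_le)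
  qed
  show "stabilizes n v m (-1) (Phi_tilde_star v k)"
    unfolding stabilizes_def
  proof (intro conjI allI impI ballI)
    fix N :: nat assume "1 \<le> N"
    then obtain N' where "N = Suc N'" "nat (int N + - 1) = N'" by (cases N) auto
    then show "linear_between (Wedge n v N) (Wedge n v (nat (int N + - 1))) (Phi_tilde_star v k N)"
      using antisymmetric_lin(3)[OF anti_front[of N' _ "- k"] anti_front[of N' _ "- k"]]
      by (auto simp: linear_between_def Wedge_iff Phi_tilde_star_def lin_add[OF lin_Phi_star]
          lin_scl[OF lin_Phi_star] scl_distrib mult.commute)
  next
    fix l w assume "w \<in> Wedge n v l"
    then have w: "anti l w" by (simp add: Wedge_iff)
    obtain c s where cs: "w \<in> supp (bounded_keys c s l)"
      using obtain_bounded_keys[OF antiD[OF w]] .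
    define L where "L = s - (\<Sum>j<l. int j - m)"
    \<comment> \<open>The summands ensure, in this order, that \<open>phi\<close> starts below N,
      that the entries of w lie below the next appended index, that -k does, and that the degree
      inequality \<open>large\<close> holds.\<close>
    define M where "M = l + nat (c + m + 1) + nat (m - k) + nat (m - k - L)"
    have step: "phi n v (m + - 1) (N + r) N (Phi_tilde_star v k (Suc N) (phi n v m (Suc N) l w)) =
        Phi_tilde_star v k (Suc N + r) (phi n v m (Suc N + r) l w)" if N: "Suc N > M" for N r
    proof (induction r)
      case (Suc r)
      let ?R = "N + r"
      have l: "l \<le> Suc ?R" using N by (simp add: M_def)
      let ?w = "phi n v m (Suc ?R) l w"
      have ord: "c \<le> int (Suc ?R) - m - 1" "- k < int (Suc ?R) - m" "0 < L + k + (int (Suc ?R) - m)"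
        using N by (simp_all add: M_def)
      have bw: "?w \<in> supp (bounded_keys (int (Suc ?R) - m - 1) (L + (\<Sum>j<Suc ?R. int j - m)) (Suc ?R))"
        using bounded_phi[OF w cs l, of m] ord(1) by (simp only: L_def max_absorb2)
      \<comment> \<open>With m - 1 the vector appended to N + r factors has index (N + r) - (m - 1)
        = (N + r + 1) - m, the one appended to N + r + 1 factors on the other side.\<close>
      have "phi n v (m + - 1) (N + Suc r) N (Phi_tilde_star v k (Suc N) (phi n v m (Suc N) l w)) =
          wedge_right n v ?R (int (Suc ?R) - m) (Phi_tilde_star v k (Suc ?R) ?w)"
        using Suc.IH phi_Suc[of N ?R "m + - 1"] by (simp add: algebra_simps)
      also have "\<dots> = Phi_tilde_star v k (Suc (Suc ?R)) (wedge_right n v (Suc ?R) (int (Suc ?R) - m) ?w)"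
        by (rule Phi_tilde_star_wedge[OF anti_phi[OF w l] bw ord(2,3), symmetric])
      also have "wedge_right n v (Suc ?R) (int (Suc ?R) - m) ?w = phi n v m (Suc (Suc ?R)) l w"
        using phi_Suc[OF l] by simp
      finally show ?case by simp
    qed (simp add: phi_refl)
    show "\<exists>M\<ge>l. \<forall>N>M. \<forall>r. phi n v (m + - 1) (nat (int (N + r) + - 1)) (nat (int N + - 1))
        (Phi_tilde_star v k N (phi n v m N l w)) = Phi_tilde_star v k (N + r) (phi n v m (N + r) l w)"
    proof (intro exI[of _ M] conjI allI impI)
      show "l \<le> M" by (simp add: M_def)
      fix N r assume N: "M < N"
      then obtain N' where N': "N = Suc N'" by (cases N) auto
      have "nat (int (N + r) + - 1) = N' + r" "nat (int N + - 1) = N'" using N' by simp_all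
      then show "phi n v (m + - 1) (nat (int (N + r) + - 1)) (nat (int N + - 1))
          (Phi_tilde_star v k N (phi n v m N l w)) = Phi_tilde_star v k (N + r) (phi n v m (N + r) l w)"
        using step[of N' r] N N' by simp
    qed
  qed
qed

end
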